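(* Let $g:S^1\to SU(2)$ be measurable, and suppose that $g$ and $g^{-1}$ have (root subgroup) factorizations $$g=k_1^*\begin{pmatrix}e^{\chi}&0\\0&e^{-\chi}\end{pmatrix}k_2,\qquad g^{-1}=(k_1')^*\begin{pmatrix}e^{\chi'}&0\\0&e^{-\chi'}\end{pmatrix}k_2',$$ with $\exp(-\chi_+),\exp(-\chi_+')\in L^2(S^1)$. If $k_1,k_1'$ have triangular factorizations of the form (I.3) and $k_2,k_2'$ have triangular factorizations of the form (II.3), then $g$ has a triangular factorization.
   Context: $\Delta$ is the open unit disk, $\Delta^*=\{|z|>1\}\cup\{\infty\}$, $H^0(U)$ denotes holomorphic functions on $U$, and $f^*$ denotes the complex conjugate of $f$ on $S^1$ ($f^*(z)=\sum\overline{f_{-n}}z^n$ for $f=\sum f_nz^n$). For loops into $SU(2)$, $k^*=k^{-1}$. Triangular factorization of $g$: $g=l\,m\,a\,u$ a.e. on $S^1$, where $l\in H^0(\Delta^*,SL(2,\mathbb C))$ with $l(\infty)$ lower triangular unipotent, $u\in H^0(\Delta,SL(2,\mathbb C))$ with $u(0)$ upper triangular unipotent, $l,u$ have $L^2$ radial limits on $S^1$, $m=\mathrm{diag}(m_0,m_0^{-1})$ with $m_0\in S^1$, $a=\mathrm{diag}(a_0,a_0^{-1})$ with $a_0>0$. $k_1,k_2,k_1',k_2':S^1\to SU(2)$ are measurable. (I.3) for $k_1$: a triangular factorization of the form $k_1=\begin{pmatrix}1&0\\\sum_{j\ge0}\overline{y_j}z^{-j}&1\end{pmatrix}\begin{pmatrix}\mathbf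 a_1&0\\0&\mathbf a_1^{-1}\end{pmatrix}\begin{pmatrix}\alpha_1&\beta_1\\\gamma_1&\delta_1\end{pmatrix}$, $\mathbf a_1>0$. (II.3) for $k_2$: a triangular factorization of the form $k_2=\begin{pmatrix}1&\sum_{j\ge1}\overline{x_j}z^{-j}\\0&1\end{pmatrix}\begin{pmatrix}\mathbf a_2&0\\0&\mathbf a_2^{-1}\end{pmatrix}\begin{pmatrix}\alpha_2&\beta_2\\\gamma_2&\delta_2\end{pmatrix}$, $\mathbf a_2>0$. (In both, the first and third factors play the roles of $l$ and $u$.) $\chi:S^1\to i\mathbb R$ is of the form $\chi=\chi_-+\chi_0+\chi_+$ with $\chi_0\in i\mathbb R$, $\chi_+$ (boundary values of) a holomorphic function in $\Delta$ with $\chi_+(0)=0$, and $\chi_-=-\chi_+^*$; $\exp(-\chi_+)\in L^2$ means that $\exp(-\chi_+)$ is a holomorphic function with $L^2$ radial boundary values (in $H^2$). Similarly for $\chi'$. *)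

theory Defs
  imports "HOL-Analysis.Analysis"
begin

type_synonym cmat2 = "complex^2^2"

text \<open>Arc length on the unit circle. The \<open>\<sigma>\<close>-algebra consists of the Lebesgue measurable
  subsets of the circle.\<close>

definition circle_measure :: "complex measure" where
  "circle_measure = embed_measure (lebesgue_on {0..<2 * pi}) cis"

definition circle_L2 :: "(complex \<Rightarrow> complex) \<Rightarrow> bool" where
  "circle_L2 b \<longleftrightarrow> b \<in> borel_measurable circle_measure \<and>
     integrable circle_measure (\<lambda>z. (cmod (b z))\<^sup>2)"

definition mat2 :: "complex \<Rightarrow> complex \<Rightarrow> complex \<Rightarrow> complex \<Rightarrow> cmat2" where
  "mat2 a b c d = vector [vector [a, b], vector [c, d]]"

definition conj_transpose :: "cmat2 \<Rightarrow> cmat2" where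
  "conj_transpose A = map_matrix cnj (transpose A)"

definition SU2 :: "cmat2 set" where
  "SU2 = {A. A ** conj_transpose A = mat 1 \<and> det A = 1}"

definition SU2_loop :: "(complex \<Rightarrow> cmat2) \<Rightarrow> bool" where
  "SU2_loop g \<longleftrightarrow> g \<in> borel_measurable circle_measure \<and> (\<forall>z\<in>sphere 0 1. g z \<in> SU2)"

text \<open>A function on \<open>\<Delta>\<^sup>*\<close> is encoded by its restriction \<open>f\<close> to \<open>{z. 1 < cmod z}\<close> and its
  value \<open>c\<close> at \<open>\<infinity>\<close>. The following is that function in the coordinate \<open>w = 1/z\<close>.\<close>

definition at_infinity_chart :: "(complex \<Rightarrow> complex) \<Rightarrow> complex \<Rightarrow> complex \<Rightarrow> complex" where
  "at_infinity_chart f c = (\<lambda>w. if w = 0 then c else f (inverse w))"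

definition radial_limit_disc :: "(complex \<Rightarrow> complex) \<Rightarrow> (complex \<Rightarrow> complex) \<Rightarrow> bool" where
  "radial_limit_disc f b \<longleftrightarrow>
     (AE z in circle_measure. ((\<lambda>r::real. f (of_real r * z)) \<longlongrightarrow> b z) (at_left 1))"

definition radial_limit_ext :: "(complex \<Rightarrow> complex) \<Rightarrow> (complex \<Rightarrow> complex) \<Rightarrow> bool" where
  "radial_limit_ext f b \<longleftrightarrow>
     (AE z in circle_measure. ((\<lambda>r::real. f (of_real r * z)) \<longlongrightarrow> b z) (at_right 1))"

definition hardy2 :: "(complex \<Rightarrow> complex) \<Rightarrow> bool" where
  "hardy2 f \<longleftrightarrow> f holomorphic_on ball 0 1 \<and>
     (\<exists>C. \<forall>r\<in>{0..<1}. (LINT z|circle_measure. (cmod (f (of_real r * z)))\<^sup>2) \<le> C)"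

text \<open>Having \<open>L\<^sup>2\<close> radial limits is understood in the sense of the Hardy space \<open>H\<^sup>2\<close>. Holomorphy
  together with square integrable radial limits would not be enough: the reciprocal of a singular
  inner function has unimodular radial limits but does not belong to \<open>H\<^sup>2\<close>.\<close>

definition L2_boundary_disc :: "(complex \<Rightarrow> complex) \<Rightarrow> (complex \<Rightarrow> complex) \<Rightarrow> bool" where
  "L2_boundary_disc f b \<longleftrightarrow> hardy2 f \<and> circle_L2 b \<and> radial_limit_disc f b"

definition L2_boundary_ext ::
    "(complex \<Rightarrow> complex) \<Rightarrow> complex \<Rightarrow> (complex \<Rightarrow> complex) \<Rightarrow> bool" where
  "L2_boundary_ext f c b \<longleftrightarrow> hardy2 (at_infinity_chart f c) \<and> circle_L2 b \<and> radial_limit_ext f b"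

definition upper_factor :: "(complex \<Rightarrow> cmat2) \<Rightarrow> (complex \<Rightarrow> cmat2) \<Rightarrow> bool" where
  "upper_factor u ub \<longleftrightarrow>
     (\<forall>i j. (\<lambda>z. u z $ i $ j) holomorphic_on ball 0 1) \<and>
     (\<forall>z\<in>ball 0 1. det (u z) = 1) \<and>
     (\<exists>c. u 0 = mat2 1 c 0 1) \<and>
     (\<forall>i j. L2_boundary_disc (\<lambda>z. u z $ i $ j) (\<lambda>z. ub z $ i $ j))"

definition lower_factor :: "(complex \<Rightarrow> cmat2) \<Rightarrow> cmat2 \<Rightarrow> (complex \<Rightarrow> cmat2) \<Rightarrow> bool" where
  "lower_factor l linf lb \<longleftrightarrow>
     (\<forall>i j. at_infinity_chart (\<lambda>z. l z $ i $ j) (linf $ i $ j) holomorphic_on ball 0 1) \<and>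
     (\<forall>z. 1 < cmod z \<longrightarrow> det (l z) = 1) \<and> det linf = 1 \<and>
     (\<exists>c. linf = mat2 1 0 c 1) \<and>
     (\<forall>i j. L2_boundary_ext (\<lambda>z. l z $ i $ j) (linf $ i $ j) (\<lambda>z. lb z $ i $ j))"

definition triangular_factorization_by ::
    "(complex \<Rightarrow> cmat2) \<Rightarrow> (complex \<Rightarrow> cmat2) \<Rightarrow> cmat2 \<Rightarrow> complex \<Rightarrow> real \<Rightarrow> (complex \<Rightarrow> cmat2) \<Rightarrow> bool"
  where
  "triangular_factorization_by g l linf m0 a0 u \<longleftrightarrow> cmod m0 = 1 \<and> 0 < a0 \<and>
     (\<exists>lb ub. lower_factor l linf lb \<and> upper_factor u ub \<and>
        (AE z in circle_measure.
           g z = lb z ** mat2 m0 0 0 (inverse m0)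
                      ** mat2 (of_real a0) 0 0 (inverse (of_real a0)) ** ub z))"

definition has_triangular_factorization :: "(complex \<Rightarrow> cmat2) \<Rightarrow> bool" where
  "has_triangular_factorization g \<longleftrightarrow>
     (\<exists>l linf m0 a0 u. triangular_factorization_by g l linf m0 a0 u)"

definition triangular_form_I3 :: "(complex \<Rightarrow> cmat2) \<Rightarrow> bool" where
  "triangular_form_I3 k \<longleftrightarrow>
     (\<exists>y f a u. triangular_factorization_by k (\<lambda>z. mat2 1 0 (f z) 1) (mat2 1 0 (cnj (y 0)) 1) 1 a u \<and>
        (\<forall>z. 1 < cmod z \<longrightarrow> (\<lambda>j. cnj (y j) * inverse z ^ j) sums f z))"

definition triangular_form_II3 :: "(complex \<Rightarrow> cmat2) \<Rightarrow> bool" where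
  "triangular_form_II3 k \<longleftrightarrow>
     (\<exists>x f a u. triangular_factorization_by k (\<lambda>z. mat2 1 (f z) 0 1) (mat2 1 0 0 1) 1 a u \<and>
        (\<forall>z. 1 < cmod z \<longrightarrow> (\<lambda>j. cnj (x (Suc j)) * inverse z ^ Suc j) sums f z))"

text \<open>This says \<open>\<chi> = \<chi>\<^sub>- + \<chi>\<^sub>0 + \<chi>\<^sub>+\<close> with \<open>\<chi>\<^sub>- = -\<chi>\<^sub>+\<^sup>*\<close>; here \<open>chi_plus\<close> is the
  holomorphic function \<open>\<chi>\<^sub>+\<close> on the disc and \<open>b\<close> its boundary function.\<close>

definition imaginary_exponent :: "(complex \<Rightarrow> complex) \<Rightarrow> (complex \<Rightarrow> complex) \<Rightarrow> bool" where
  "imaginary_exponent chi chi_plus \<longleftrightarrow>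
     (\<forall>z\<in>sphere 0 1. Re (chi z) = 0) \<and> chi_plus holomorphic_on ball 0 1 \<and> chi_plus 0 = 0 \<and>
     (\<exists>chi_0 b. Re chi_0 = 0 \<and> radial_limit_disc chi_plus b \<and>
        (AE z in circle_measure. chi z = - cnj (b z) + chi_0 + b z))"

end

theory Submission
  imports Defs "HOL-Complex_Analysis.Cauchy_Integral_Formula"
begin

text \<open>Applying \<open>g = k\<^sub>1\<^sup>* e\<^sup>\<chi> k\<^sub>2\<close> to \<open>exp (- \<chi>\<^sub>+) (\<delta>\<^sub>2, - \<gamma>\<^sub>2)\<close> gives a constant multiple of
  \<open>(exp (- \<chi>\<^sub>+) (\<alpha>\<^sub>1, \<beta>\<^sub>1))\<^sup>*\<close>. The entries of the former are in \<open>H\<^sup>2\<close> and those of the latter are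
  conjugates of \<open>H\<^sup>2\<close> functions, because \<open>\<alpha>\<^sub>1, \<beta>\<^sub>1, \<gamma>\<^sub>2, \<delta>\<^sub>2\<close> are bounded by unitarity of the \<open>k\<^sub>i\<close>. This
  is the first column of the equation \<open>g u\<^sup>-\<^sup>1 = l m a\<close>. The factorization of \<open>g\<^sup>-\<^sup>1 = g\<^sup>*\<close> provides the
  second column in the same way, up to a constant. Comparing determinants, an \<open>H\<^sup>1\<close> function
  agrees on the circle with a multiple of an antiholomorphic one; hence both are constant, their values
  at \<open>0\<close> and \<open>\<infinity>\<close> show that \<open>l\<close> and \<open>u\<close> have determinant \<open>1\<close>, and the two constants match.\<close>

section \<open>Integration over the unit circle\<close>

lemma inj_on_cis: "inj_on cis {0..<2 * pi}"
  by (intro inj_onI) (metis Arg2pi_unique atLeastLessThan_iff cis_conv_exp mult_1 of_real_1 zero_less_one)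

lemma space_circle_measure: "space circle_measure = sphere 0 1"
proof -
  have "cis ` {0..<2 * pi} = sphere 0 1"
  proof (intro equalityI subsetI)
    fix z :: complex assume "z \<in> sphere 0 1"
    then have "z = cis (Arg2pi z)"
      by (metis Arg2pi_eq cis_conv_exp dist_0_norm mem_sphere mult_1 of_real_1)
    then show "z \<in> cis ` {0..<2 * pi}"
      using Arg2pi_ge_0 Arg2pi_lt_2pi by (metis atLeastLessThan_iff imageI)
  qed auto
  then show ?thesis
    by (simp add: circle_measure_def space_embed_measure)
qed

lemma circle_measure_cis_measurable: "cis \<in> measurable (lebesgue_on {0..<2 * pi}) circle_measure"
  unfolding circle_measure_def by (rule measurable_embed_measure2') (simp add: inj_on_cis)

text \<open>Since \<open>cis\<close> is injective on the half-open interval, the embedded measure is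
  a push-forward. This turns integrals over the circle into integrals in the angle.\<close>

lemma circle_measure_eq_distr:
  "circle_measure = distr (lebesgue_on {0..<2 * pi}) circle_measure cis"
  unfolding circle_measure_def by (rule embed_measure_eq_distr') (simp add: inj_on_cis)

lemma emeasure_circle_measure: "emeasure circle_measure (space circle_measure) = ennreal (2 * pi)"
proof -
  have "emeasure circle_measure (space circle_measure) =
      emeasure (lebesgue_on {0..<2 * pi}) (space (lebesgue_on {0..<2 * pi}))"
    by (subst circle_measure_eq_distr, subst emeasure_distr)
       (use circle_measure_cis_measurable in \<open>auto simp: measurable_space
          intro!: arg_cong[where f="emeasure _"] dest: measurable_space\<close>)
  also have "\<dots> = ennreal (2 * pi)"
    by (simp add: emeasure_restrict_space)
  finally show ?thesis .
qed

interpretation circle: finite_measure circle_measure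
  by standard (simp add: emeasure_circle_measure)

lemma measure_circle_measure: "measure circle_measure (sphere 0 1) = 2 * pi"
  using emeasure_circle_measure by (simp add: measure_def space_circle_measure)

lemma circle_measurable_continuous:
  assumes "continuous_on (sphere 0 1) f"
  shows "f \<in> borel_measurable circle_measure"
proof -
  have "continuous_on {0..<2 * pi} (\<lambda>t. f (cis t))"
    by (intro continuous_on_compose2[OF assms] continuous_intros) auto
  then have "(\<lambda>t. f (cis t)) \<in> borel_measurable (lebesgue_on {0..<2 * pi})"
    by (intro continuous_imp_measurable_on_sets_lebesgue) auto
  then show ?thesis
    unfolding circle_measure_def by (rule measurable_embed_measure1)
qed

lemma circle_integrable_bounded:
  fixes f :: "complex \<Rightarrow> 'a :: {banach, second_countable_topology}"
  assumes "f \<in> borel_measurable circle_measure" "\<And>z. cmod z = 1 \<Longrightarrow> norm (f z) \<le> B"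
  shows "integrable circle_measure f"
  by (rule circle.integrable_const_bound[of _ B]) (use assms in \<open>auto simp: space_circle_measure intro!: AE_I2\<close>)

lemma circle_integrable_continuous:
  fixes f :: "complex \<Rightarrow> 'a :: {banach, second_countable_topology}"
  assumes "continuous_on (sphere 0 1) f"
  shows "integrable circle_measure f"
proof -
  have "compact (f ` sphere 0 1)"
    by (intro compact_continuous_image assms) auto
  then obtain B where "\<And>z. cmod z = 1 \<Longrightarrow> norm (f z) \<le> B"
    by (force dest!: compact_imp_bounded simp: bounded_iff)
  then show ?thesis
    by (intro circle_integrable_bounded[of _ B] circle_measurable_continuous assms)
qed

text \<open>In the angle \<open>t\<close> the integrand is \<open>cis (k * t)\<close> with
  \<open>k\<close> an integer, and for \<open>k\<close> nonzero its primitive is periodic. The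
  measure has total mass \<open>2 * pi\<close>, hence this factor in the formulas below.\<close>

lemma circle_orthogonality:
  "(LINT z|circle_measure. z ^ m * cnj z ^ n) = (if m = n then 2 * of_real pi else 0)"
proof -
  define k where "k = real m - real n"
  have "(LINT z|circle_measure. z ^ m * cnj z ^ n) =
      (LINT t|lebesgue_on {0..<2 * pi}. cis t ^ m * cnj (cis t) ^ n)"
    by (subst circle_measure_eq_distr, subst integral_distr[OF circle_measure_cis_measurable])
       (auto intro!: circle_measurable_continuous continuous_intros)
  also have "\<dots> = (LINT t|lebesgue_on {0..<2 * pi}. cis (k * t))"
  proof (intro Bochner_Integration.integral_cong refl)
    fix t
    have "cis t ^ m * cnj (cis t) ^ n = cis (real m * t) * cis (real n * (- t))"
      by (simp only: Complex.DeMoivre cis_cnj)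
    then show "cis t ^ m * cnj (cis t) ^ n = cis (k * t)"
      by (simp add: cis_mult k_def algebra_simps)
  qed
  also have "\<dots> = (if m = n then 2 * of_real pi else 0)"
  proof (cases "m = n")
    case True
    then show ?thesis
      by (simp add: k_def measure_restrict_space  scaleR_conv_of_real)
  next
    case False
    then have k: "k \<noteq> 0" by (simp add: k_def)
    have "((\<lambda>t. cis (k * t)) has_integral (cis (k * (2*pi)) / (\<i> * k) - cis (k * 0) / (\<i> * k))) {0..2*pi}"
    proof (rule fundamental_theorem_of_calculus)
      fix t
      have "((\<lambda>t. exp (\<i> * k * t) / (\<i> * k)) has_field_derivative exp (\<i> * k * of_real t)) (at (of_real t))"
        using k by (auto intro!: derivative_eq_intros)
      from has_vector_derivative_real_field[OF this, of "{0..2*pi}"]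
      show "((\<lambda>t. cis (k * t) / (\<i> * k)) has_vector_derivative cis (k * t)) (at t within {0..2*pi})"
        by (simp add: cis_conv_exp mult.assoc)
    qed simp
    moreover have "cis (k * (2*pi)) = 1"
    proof -
      have "k * (2 * pi) = 2 * pi * k" by simp
      moreover have "k \<in> \<int>" by (simp add: k_def)
      ultimately show ?thesis by (metis cis_multiple_2pi)
    qed
    ultimately have "((\<lambda>t. cis (k * t)) has_integral 0) {0..2*pi}"
      by simp
    \<comment> \<open>The fundamental theorem uses the closed interval, while the measure lives on
      the half-open one; the endpoint is negligible.\<close>
    then have "((\<lambda>t. cis (k * t)) has_integral 0) {0..<2*pi}"
    proof (subst has_integral_spike_set_eq)
      have "{0..<2 * pi} - {0..2 * pi} = {}" by auto
      then have "{t \<in> {0..<2 * pi} - {0..2 * pi}. cis (k * t) \<noteq> 0} = {}" by blast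
      then show "negligible {t \<in> {0..<2 * pi} - {0..2 * pi}. cis (k * t) \<noteq> 0}"
        by (simp only: negligible_empty)
      have "{0..2 * pi} - {0..<2 * pi} \<subseteq> {2 * pi}" by auto
      then show "negligible {t \<in> {0..2 * pi} - {0..<2 * pi}. cis (k * t) \<noteq> 0}"
        by (intro negligible_subset[OF negligible_sing[of "2 * pi"]]) blast
    qed
    moreover have "integrable (lebesgue_on {0..<2*pi}) (\<lambda>t. cis (k * t))"
    proof (rule finite_measure.integrable_const_bound[of _ _ 1])
      show "finite_measure (lebesgue_on {0..<2 * pi})"
        by standard (simp add: emeasure_restrict_space)
      show "(\<lambda>t. cis (k * t)) \<in> borel_measurable (lebesgue_on {0..<2 * pi})"
        by (intro continuous_imp_measurable_on_sets_lebesgue continuous_intros) auto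
    qed auto
    ultimately show ?thesis
      using False by (simp add: lebesgue_integral_eq_integral integral_unique)
  qed
  finally show ?thesis .
qed

section \<open>Power series on the disc and the Parseval identity\<close>

text \<open>Every term is dominated by \<open>cmod (c n) * B\<close>, so sum and integral may be
  exchanged. In all uses \<open>e n\<close> is a power of \<open>z\<close> or of
  \<open>cnj z\<close>.\<close>

lemma circle_integral_sums:
  fixes c :: "nat \<Rightarrow> complex"
  assumes c: "summable (\<lambda>n. cmod (c n))"
    and e: "\<And>n. e n \<in> borel_measurable circle_measure" "\<And>n z. cmod z = 1 \<Longrightarrow> cmod (e n z) \<le> 1"
    and h: "h \<in> borel_measurable circle_measure" "\<And>z. cmod z = 1 \<Longrightarrow> cmod (h z) \<le> B"
  shows "(\<lambda>n. c n * (LINT z|circle_measure. e n z * h z)) sums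
           (LINT z|circle_measure. (\<Sum>n. c n * e n z) * h z)"
proof -
  let ?f = "\<lambda>n z. c n * e n z * h z"
  have "0 \<le> B"
    by (rule order_trans[OF norm_ge_zero h(2)[of 1]]) simp
  have bound: "cmod (?f n z) \<le> cmod (c n) * B" if "cmod z = 1" for n z
    using mult_mono[OF e(2)[OF that, of n] h(2)[OF that]]
    by (auto simp: norm_mult mult.assoc intro!: mult_left_mono)
  have int: "integrable circle_measure (?f n)" for n
    by (rule circle_integrable_bounded[OF _ bound]) (use e h in auto)
  have summ: "summable (\<lambda>n. cmod (c n) * B)"
    by (intro summable_mult2 c)
  have "summable (\<lambda>n. LINT z|circle_measure. cmod (?f n z))"
  proof (rule summable_comparison_test')
    show "summable (\<lambda>n. cmod (c n) * B * (2 * pi))"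
      by (intro summable_mult2 summ)
    show "norm (LINT z|circle_measure. cmod (?f n z)) \<le> cmod (c n) * B * (2 * pi)" for n
    proof -
      have "(LINT z|circle_measure. cmod (?f n z)) \<le> (LINT z|circle_measure. cmod (c n) * B)"
        by (intro integral_mono) (use int bound in \<open>auto simp: space_circle_measure\<close>)
      then show ?thesis
        by (simp add: space_circle_measure measure_circle_measure mult_ac)
    qed
  qed
  moreover have "AE z in circle_measure. summable (\<lambda>n. norm (?f n z))"
    by (intro AE_I2 summable_comparison_test'[OF summ, where N=0])
       (use bound in \<open>auto simp: space_circle_measure\<close>)
  ultimately have "(\<lambda>n. integral\<^sup>L circle_measure (?f n)) sums (LINT z|circle_measure. (\<Sum>n. ?f n z))"
    by (intro sums_integral int)
  moreover have "(LINT z|circle_measure. (\<Sum>n. ?f n z)) =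
      (LINT z|circle_measure. (\<Sum>n. c n * e n z) * h z)"
  proof (intro Bochner_Integration.integral_cong refl)
    fix z assume "z \<in> space circle_measure"
    then have "cmod z = 1" by (simp add: space_circle_measure)
    then have "summable (\<lambda>n. c n * e n z)"
      by (intro summable_comparison_test'[OF c, where N=0])
         (auto simp: norm_mult intro!: mult_left_le e)
    then show "(\<Sum>n. ?f n z) = (\<Sum>n. c n * e n z) * h z"
      by (rule suminf_mult2[symmetric])
  qed
  ultimately show ?thesis
    by (simp add: mult.assoc)
qed

text \<open>Carrying the Taylor coefficients as a parameter turns membership in the Hardy space into
  square summability of \<open>a\<close>, and lets conjugates and differences of dilates be treated
  as further instances.\<close>

locale disc_series =
  fixes F :: "complex \<Rightarrow> complex" and a :: "nat \<Rightarrow> complex"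
  assumes sums: "cmod z < 1 \<Longrightarrow> (\<lambda>n. a n * z ^ n) sums F z"
begin

lemma holomorphic: "F holomorphic_on ball 0 1"
  using sums by (intro power_series_holomorphic[where a=a]) auto

lemma abs_summable:
  assumes "0 \<le> r" "r < 1"
  shows "summable (\<lambda>n. cmod (a n * of_real r ^ n))"
proof (rule powser_insidea)
  \<comment> \<open>The midpoint lies strictly between \<open>r\<close> and 1; convergence there
    gives absolute convergence at \<open>r\<close>.\<close>
  show "summable (\<lambda>n. a n * of_real ((r + 1) / 2) ^ n)"
    by (rule sums_summable[OF sums]) (use assms in \<open>auto simp del: of_real_add of_real_divide\<close>)
  show "cmod (of_real r) < cmod (of_real ((r + 1) / 2))"
    by (simp only: norm_of_real) (use assms in auto)
qed

lemma dilate_continuous: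
  assumes "0 \<le> r" "r < 1"
  shows "continuous_on (sphere 0 1) (\<lambda>z. F (of_real r * z))"
  by (intro continuous_on_compose2[OF holomorphic_on_imp_continuous_on[OF holomorphic]] continuous_intros)
     (use assms in \<open>auto simp: norm_mult\<close>)

lemma dilate_bounded:
  assumes "0 \<le> r" "r < 1"
  obtains B where "\<And>z. cmod z = 1 \<Longrightarrow> cmod (F (of_real r * z)) \<le> B"
proof -
  have "compact ((\<lambda>z. F (of_real r * z)) ` sphere 0 1)"
    by (intro compact_continuous_image dilate_continuous assms) auto
  then show ?thesis
    using that by (force dest!: compact_imp_bounded simp: bounded_iff)
qed

lemma suminf_dilate:
  assumes "0 \<le> r" "r < 1" "cmod z = 1"
  shows "(\<Sum>n. a n * of_real r ^ n * z ^ n) = F (of_real r * z)"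
  using sums[of "of_real r * z"] assms
  by (simp add: norm_mult sums_iff power_mult_distrib mult.assoc)

text \<open>Termwise integration over the circle of radius \<open>r\<close>: orthogonality leaves
  only the monomial of degree \<open>n\<close>.\<close>

lemma coefficient:
  assumes r: "0 \<le> r" "r < 1"
  shows "(LINT z|circle_measure. F (of_real r * z) * cnj z ^ n) = 2 * pi * a n * of_real r ^ n"
proof -
  have "(\<lambda>m. a m * of_real r ^ m * (LINT z|circle_measure. z ^ m * cnj z ^ n)) sums
      (LINT z|circle_measure. (\<Sum>m. a m * of_real r ^ m * z ^ m) * cnj z ^ n)"
    by (rule circle_integral_sums[OF abs_summable[OF r], where B=1])
       (auto simp: norm_power intro!: circle_measurable_continuous continuous_intros)
  also have "(LINT z|circle_measure. (\<Sum>m. a m * of_real r ^ m * z ^ m) * cnj z ^ n) =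
      (LINT z|circle_measure. F (of_real r * z) * cnj z ^ n)"
    by (intro Bochner_Integration.integral_cong) (auto simp: suminf_dilate[OF r] space_circle_measure)
  finally have "(\<lambda>m. if m = n then a m * of_real r ^ m * (2 * of_real pi) else 0) sums
      (LINT z|circle_measure. F (of_real r * z) * cnj z ^ n)"
    by (simp add: circle_orthogonality if_distrib cong: if_cong)
  then have "(LINT z|circle_measure. F (of_real r * z) * cnj z ^ n) = a n * of_real r ^ n * (2 * of_real pi)"
    by (rule sums_unique2) (rule sums_single)
  also have "\<dots> = 2 * pi * a n * of_real r ^ n"
    by simp
  finally show ?thesis .
qed

text \<open>Only one factor of \<open>F * cnj F\<close> is expanded; integrating the other against a
  monomial gives a conjugated Taylor coefficient by \<open>coefficient\<close>.\<close>

lemma parseval: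
  assumes r: "0 \<le> r" "r < 1"
  shows "(\<lambda>n. 2 * pi * ((cmod (a n))\<^sup>2 * (r\<^sup>2) ^ n)) sums
           (LINT z|circle_measure. (cmod (F (of_real r * z)))\<^sup>2)"
proof -
  obtain B where B: "\<And>z. cmod z = 1 \<Longrightarrow> cmod (F (of_real r * z)) \<le> B"
    using dilate_bounded[OF r] by blast
  have "(\<lambda>n. a n * of_real r ^ n * (LINT z|circle_measure. z ^ n * cnj (F (of_real r * z)))) sums
      (LINT z|circle_measure. (\<Sum>n. a n * of_real r ^ n * z ^ n) * cnj (F (of_real r * z)))"
    by (rule circle_integral_sums[OF abs_summable[OF r], where B=B])
       (auto simp: norm_power B intro!: circle_measurable_continuous continuous_intros dilate_continuous r)
  also have "(LINT z|circle_measure. (\<Sum>n. a n * of_real r ^ n * z ^ n) * cnj (F (of_real r * z))) =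
      (LINT z|circle_measure. of_real ((cmod (F (of_real r * z)))\<^sup>2))"
    by (intro Bochner_Integration.integral_cong)
       (auto simp: suminf_dilate[OF r] space_circle_measure complex_norm_square simp del: of_real_power)
  also have "\<dots> = of_real (LINT z|circle_measure. (cmod (F (of_real r * z)))\<^sup>2)"
    by (rule integral_complex_of_real)
  also have "(\<lambda>n. a n * of_real r ^ n * (LINT z|circle_measure. z ^ n * cnj (F (of_real r * z)))) =
      (\<lambda>n. of_real (2 * pi * ((cmod (a n))\<^sup>2 * (r\<^sup>2) ^ n)))"
  proof
    fix n
    have "(LINT z|circle_measure. z ^ n * cnj (F (of_real r * z))) =
        cnj (LINT z|circle_measure. F (of_real r * z) * cnj z ^ n)"
      by (simp only: Bochner_Integration.integral_cnj[symmetric] complex_cnj_mult complex_cnj_power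
          complex_cnj_cnj mult.commute)
    also have "\<dots> = 2 * pi * cnj (a n) * of_real r ^ n"
      by (simp add: coefficient[OF r])
    finally have "a n * of_real r ^ n * (LINT z|circle_measure. z ^ n * cnj (F (of_real r * z))) =
        2 * pi * (a n * cnj (a n)) * (of_real r ^ n * of_real r ^ n)"
      by (simp add: ac_simps)
    also have "\<dots> = of_real (2 * pi * ((cmod (a n))\<^sup>2 * (r\<^sup>2) ^ n))"
      by (simp add: complex_norm_square[symmetric] power2_eq_square power_mult_distrib)
    finally show "a n * of_real r ^ n * (LINT z|circle_measure. z ^ n * cnj (F (of_real r * z))) =
        of_real (2 * pi * ((cmod (a n))\<^sup>2 * (r\<^sup>2) ^ n))" .
  qed
  finally show ?thesis
    by (simp only: sums_of_real_iff)
qed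

text \<open>Cauchy's formula for the dilated function with respect to arc length: on the circle
  \<open>1 / (1 - w * cnj z)\<close> equals \<open>z / (z - w)\<close>. The kernel is expanded as a
  geometric series.\<close>

lemma cauchy_kernel:
  assumes r: "0 \<le> r" "r < 1" and w: "cmod w < 1"
  shows "(LINT z|circle_measure. F (of_real r * z) / (1 - w * cnj z)) = 2 * pi * F (of_real r * w)"
proof -
  obtain B where B: "\<And>z. cmod z = 1 \<Longrightarrow> cmod (F (of_real r * z)) \<le> B"
    using dilate_bounded[OF r] by blast
  have "(\<lambda>n. w ^ n * (LINT z|circle_measure. cnj z ^ n * F (of_real r * z))) sums
      (LINT z|circle_measure. (\<Sum>n. w ^ n * cnj z ^ n) * F (of_real r * z))"
    by (rule circle_integral_sums[where B=B])
       (use w in \<open>auto simp: norm_power B intro!: circle_measurable_continuous continuous_intros dilate_continuous r\<close>)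
  also have "(LINT z|circle_measure. (\<Sum>n. w ^ n * cnj z ^ n) * F (of_real r * z)) =
      (LINT z|circle_measure. F (of_real r * z) / (1 - w * cnj z))"
    using w by (intro Bochner_Integration.integral_cong)
       (auto simp: space_circle_measure norm_mult suminf_geometric simp flip: power_mult_distrib)
  also have "(\<lambda>n. w ^ n * (LINT z|circle_measure. cnj z ^ n * F (of_real r * z))) =
      (\<lambda>n. 2 * pi * (a n * (of_real r * w) ^ n))"
    using coefficient[OF r] by (simp add: power_mult_distrib ac_simps)
  finally have "(\<lambda>n. 2 * pi * (a n * (of_real r * w) ^ n)) sums
      (LINT z|circle_measure. F (of_real r * z) / (1 - w * cnj z))" .
  moreover have "cmod (of_real r * w) < 1"
    using mult_mono[of r 1 "cmod w" "cmod w"] r w by (simp add: norm_mult)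
  then have "(\<lambda>n. 2 * pi * (a n * (of_real r * w) ^ n)) sums (2 * pi * F (of_real r * w))"
    by (intro sums_mult sums)
  ultimately show ?thesis
    using sums_unique2 by blast
qed

lemma cnj_series: "disc_series (\<lambda>w. cnj (F (cnj w))) (\<lambda>n. cnj (a n))"
proof
  fix z :: complex assume "cmod z < 1"
  then have "(\<lambda>n. a n * cnj z ^ n) sums F (cnj z)" by (intro sums) simp
  then show "(\<lambda>n. cnj (a n) * z ^ n) sums cnj (F (cnj z))"
    by (subst (asm) sums_cnj[symmetric]) simp
qed

text \<open>The dilate has coefficients \<open>a n * t ^ n\<close>. Parseval for the difference then
  measures in mean square how far \<open>F\<close> is from its dilate.\<close>

lemma difference_series:
  assumes "0 \<le> t" "t < 1"
  shows "disc_series (\<lambda>z. F z - F (of_real t * z)) (\<lambda>n. a n * of_real (1 - t ^ n))"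
proof
  fix z :: complex assume z: "cmod z < 1"
  have "cmod (of_real t * z) < 1"
    using mult_mono[of t 1 "cmod z" "cmod z"] assms z by (simp add: norm_mult)
  from sums_diff[OF sums[OF z] sums[OF this]]
  show "(\<lambda>n. a n * of_real (1 - t ^ n) * z ^ n) sums (F z - F (of_real t * z))"
    by (simp add: algebra_simps power_mult_distrib)
qed

text \<open>In a finite partial sum of Parseval's series the radius may tend to 1, so all partial
  sums stay below the Hardy bound.\<close>

lemma hardy2_imp_summable:
  assumes "hardy2 F"
  shows "summable (\<lambda>n. (cmod (a n))\<^sup>2)"
proof -
  obtain C where C: "\<And>r. 0 \<le> r \<Longrightarrow> r < 1 \<Longrightarrow> (LINT z|circle_measure. (cmod (F (of_real r * z)))\<^sup>2) \<le> C"
    using assms unfolding hardy2_def by force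
  have "(\<Sum>n<N. 2 * pi * (cmod (a n))\<^sup>2) \<le> C" for N
  proof (rule tendsto_upperbound)
    show "((\<lambda>r. \<Sum>n<N. 2 * pi * ((cmod (a n))\<^sup>2 * (r\<^sup>2) ^ n)) \<longlongrightarrow> (\<Sum>n<N. 2 * pi * (cmod (a n))\<^sup>2)) (at_left 1)"
      by (auto intro!: tendsto_eq_intros)
    have "\<forall>\<^sub>F r in at_left 1. 0 < r \<and> r < (1::real)"
      using eventually_at_left_real[of 0 1] by simp
    then show "\<forall>\<^sub>F r in at_left 1. (\<Sum>n<N. 2 * pi * ((cmod (a n))\<^sup>2 * (r\<^sup>2) ^ n)) \<le> C"
    proof eventually_elim
      case (elim r)
      then have "(\<Sum>n<N. 2 * pi * ((cmod (a n))\<^sup>2 * (r\<^sup>2) ^ n)) \<le>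
          (\<Sum>n. 2 * pi * ((cmod (a n))\<^sup>2 * (r\<^sup>2) ^ n))"
        using parseval[of r] by (intro sum_le_suminf) (auto simp: sums_iff)
      also have "\<dots> \<le> C"
        using parseval[of r] C[of r] elim by (simp add: sums_iff)
      finally show ?case .
    qed
  qed auto
  then have "summable (\<lambda>n. 2 * pi * (cmod (a n))\<^sup>2)"
    by (intro summableI_nonneg_bounded) auto
  then show ?thesis
    by (simp add: summable_cmult_iff)
qed

text \<open>The weights \<open>(r\<^sup>2) ^ n\<close> in Parseval's series are at most 1, which
  makes the bound uniform in \<open>r\<close>.\<close>

lemma dilate_integral_le:
  assumes s: "summable (\<lambda>n. (cmod (a n))\<^sup>2)" and r: "0 \<le> r" "r < 1"
  shows "(LINT z|circle_measure. (cmod (F (of_real r * z)))\<^sup>2) \<le> 2 * pi * (\<Sum>n. (cmod (a n))\<^sup>2)"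
proof -
  have "r\<^sup>2 \<le> 1"
    using r by (simp add: power_le_one)
  then have "(r\<^sup>2) ^ n \<le> 1" for n
    by (simp add: power_le_one)
  then show ?thesis
    using parseval[OF r] summable_mult[OF s, of "2*pi"]
    by (intro sums_le[OF _ parseval[OF r] sums_mult[OF summable_sums[OF s], of "2*pi"]])
       (auto intro!: mult_left_mono mult_left_le)
qed

lemma hardy2_iff_summable: "hardy2 F \<longleftrightarrow> summable (\<lambda>n. (cmod (a n))\<^sup>2)"
proof
  assume s: "summable (\<lambda>n. (cmod (a n))\<^sup>2)"
  then show "hardy2 F"
    unfolding hardy2_def using holomorphic dilate_integral_le[OF s] atLeastLessThan_iff by blast
qed (rule hardy2_imp_summable)

end

lemma holomorphic_imp_disc_series:
  assumes "F holomorphic_on ball 0 1"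
  shows "disc_series F (\<lambda>n. (deriv ^^ n) F 0 / fact n)"
  by standard (use holomorphic_power_series[OF assms] in auto)

text \<open>Conjugating the Taylor coefficients keeps their moduli. In the coordinate at infinity
  this operation is the reflection in the circle, which produces the exterior factor.\<close>

lemma hardy2_cnj:
  assumes "hardy2 F"
  shows "hardy2 (\<lambda>w. cnj (F (cnj w)))"
proof -
  interpret disc_series F "\<lambda>n. (deriv ^^ n) F 0 / fact n"
    by (rule holomorphic_imp_disc_series) (use assms in \<open>simp add: hardy2_def\<close>)
  interpret cnj: disc_series "\<lambda>w. cnj (F (cnj w))" "\<lambda>n. cnj ((deriv ^^ n) F 0 / fact n)"
    by (rule cnj_series)
  show ?thesis
    using assms unfolding hardy2_iff_summable cnj.hardy2_iff_summable complex_mod_cnj .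
qed

section \<open>Boundary values of Hardy space functions\<close>

lemma circle_L2_continuous:
  assumes "continuous_on (sphere 0 1) f"
  shows "circle_L2 f"
  unfolding circle_L2_def
  by (intro conjI circle_measurable_continuous circle_integrable_continuous continuous_intros assms)

lemma circle_L2_diff:
  assumes "circle_L2 p" "circle_L2 q"
  shows "circle_L2 (\<lambda>z. p z - q z)"
proof -
  have [measurable]: "p \<in> borel_measurable circle_measure" "q \<in> borel_measurable circle_measure"
    using assms by (auto simp: circle_L2_def)
  have "integrable circle_measure (\<lambda>z. 2 * (cmod (p z))\<^sup>2 + 2 * (cmod (q z))\<^sup>2)"
    using assms by (auto simp: circle_L2_def)
  then have "integrable circle_measure (\<lambda>z. (cmod (p z - q z))\<^sup>2)"
  proof (rule Bochner_Integration.integrable_bound, measurable, intro AE_I2)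
    fix z
    have "(cmod (p z - q z))\<^sup>2 \<le> (cmod (p z) + cmod (q z))\<^sup>2"
      by (intro power_mono norm_triangle_ineq4) auto
    also have "\<dots> \<le> 2 * (cmod (p z))\<^sup>2 + 2 * (cmod (q z))\<^sup>2"
      using sum_squares_bound[of "cmod (p z)" "cmod (q z)"] by (simp add: power2_sum)
    finally show "norm ((cmod (p z - q z))\<^sup>2) \<le> norm (2 * (cmod (p z))\<^sup>2 + 2 * (cmod (q z))\<^sup>2)"
      by simp
  qed
  then show ?thesis
    by (simp add: circle_L2_def)
qed

lemma circle_L2_integrable_mult:
  assumes "circle_L2 p" "circle_L2 q"
  shows "integrable circle_measure (\<lambda>z. p z * q z)"
proof -
  have [measurable]: "p \<in> borel_measurable circle_measure" "q \<in> borel_measurable circle_measure"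
    using assms by (auto simp: circle_L2_def)
  have "integrable circle_measure (\<lambda>z. (cmod (p z))\<^sup>2 + (cmod (q z))\<^sup>2)"
    using assms by (auto simp: circle_L2_def)
  then show ?thesis
  proof (rule Bochner_Integration.integrable_bound, measurable, intro AE_I2)
    fix z
    have "cmod (p z) * cmod (q z) \<le> (cmod (p z))\<^sup>2 + (cmod (q z))\<^sup>2"
      using sum_squares_bound[of "cmod (p z)" "cmod (q z)"]
        mult_nonneg_nonneg[OF norm_ge_zero norm_ge_zero, of "p z" "q z"] by linarith
    then show "norm (p z * q z) \<le> norm ((cmod (p z))\<^sup>2 + (cmod (q z))\<^sup>2)"
      by (simp add: norm_mult)
  qed
qed

text \<open>Transferred from the inequality for nonnegative extended integrals, all of which are
  finite here.\<close>

lemma circle_L2_cauchy_schwarz: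
  assumes "circle_L2 p" "circle_L2 q"
  shows "(LINT z|circle_measure. cmod (p z * q z)) \<le>
    sqrt (LINT z|circle_measure. (cmod (p z))\<^sup>2) * sqrt (LINT z|circle_measure. (cmod (q z))\<^sup>2)"
proof -
  have m[measurable]: "p \<in> borel_measurable circle_measure" "q \<in> borel_measurable circle_measure"
    and i: "integrable circle_measure (\<lambda>z. (cmod (p z))\<^sup>2)" "integrable circle_measure (\<lambda>z. (cmod (q z))\<^sup>2)"
    using assms by (auto simp: circle_L2_def)
  have nn: "(\<integral>\<^sup>+z. ennreal ((cmod (p z))\<^sup>2) \<partial>circle_measure) = ennreal (LINT z|circle_measure. (cmod (p z))\<^sup>2)"
    "(\<integral>\<^sup>+z. ennreal ((cmod (q z))\<^sup>2) \<partial>circle_measure) = ennreal (LINT z|circle_measure. (cmod (q z))\<^sup>2)"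
    using i by (simp_all add: nn_integral_eq_integral)
  have "(\<integral>\<^sup>+z. ennreal (cmod (p z)) * ennreal (cmod (q z)) \<partial>circle_measure) =
      ennreal (LINT z|circle_measure. cmod (p z * q z))"
    using integrable_norm[OF circle_L2_integrable_mult[OF assms]]
    by (simp add: nn_integral_eq_integral norm_mult flip: ennreal_mult)
  with Cauchy_Schwarz_nn_integral[of "\<lambda>z. ennreal (cmod (p z))" circle_measure "\<lambda>z. ennreal (cmod (q z))"]
  have "(LINT z|circle_measure. cmod (p z * q z))\<^sup>2 \<le>
      (LINT z|circle_measure. (cmod (p z))\<^sup>2) * (LINT z|circle_measure. (cmod (q z))\<^sup>2)"
    by (simp add: nn ennreal_power flip: ennreal_mult)
  then have "(LINT z|circle_measure. cmod (p z * q z)) \<le>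
      sqrt ((LINT z|circle_measure. (cmod (p z))\<^sup>2) * (LINT z|circle_measure. (cmod (q z))\<^sup>2))"
    by (rule real_le_rsqrt)
  then show ?thesis
    by (simp add: real_sqrt_mult)
qed

lemma holomorphic_circle_L2:
  assumes "f holomorphic_on ball 0 1" "0 \<le> r" "r < 1"
  shows "circle_L2 (\<lambda>z. f (of_real r * z))"
  by (rule circle_L2_continuous) (rule disc_series.dilate_continuous[OF holomorphic_imp_disc_series[OF assms(1)] assms(2,3)])

text \<open>Fatou's lemma along the radius, applied to \<open>z \<mapsto> f z - f (t z)\<close>, replaces completeness of
  \<open>L\<^sup>2\<close>: it identifies the given radial limit with the limit in the mean.\<close>

lemma hardy2_radial_mean_limit:
  assumes f: "L2_boundary_disc f b"
    and t: "\<And>k. 0 \<le> t k" "\<And>k. t k < 1" "filterlim t (at_left 1) sequentially"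
  shows "(\<lambda>k. LINT z|circle_measure. (cmod (f (of_real (t k) * z) - b z))\<^sup>2) \<longlonglongrightarrow> 0"
proof -
  define a where "a = (\<lambda>n. (deriv ^^ n) f 0 / fact n)"
  interpret disc_series f a
    unfolding a_def by (rule holomorphic_imp_disc_series) (use f in \<open>simp add: L2_boundary_disc_def hardy2_def\<close>)
  have sq: "summable (\<lambda>n. (cmod (a n))\<^sup>2)"
    using f hardy2_iff_summable by (simp add: L2_boundary_disc_def)
  have b: "circle_L2 b" and lim: "AE z in circle_measure. ((\<lambda>r. f (of_real r * z)) \<longlongrightarrow> b z) (at_left 1)"
    using f by (auto simp: L2_boundary_disc_def radial_limit_disc_def)
  have [measurable]: "b \<in> borel_measurable circle_measure"
    using b by (simp add: circle_L2_def)
  \<comment> \<open>For a fixed radius \<open>s\<close> the distance to the boundary function is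
    controlled by the Taylor coefficients of \<open>f\<close> minus its dilate.\<close>
  have le: "(LINT z|circle_measure. (cmod (f (of_real s * z) - b z))\<^sup>2) \<le>
      2 * pi * (\<Sum>n. (cmod (a n * of_real (1 - s ^ n)))\<^sup>2)" (is "_ \<le> ?C") if s: "0 \<le> s" "s < 1" for s
  proof -
    interpret d: disc_series "\<lambda>z. f z - f (of_real s * z)" "\<lambda>n. a n * of_real (1 - s ^ n)"
      by (rule difference_series[OF s])
    have sqd: "summable (\<lambda>n. (cmod (a n * of_real (1 - s ^ n)))\<^sup>2)"
    proof (rule summable_comparison_test'[OF sq])
      fix n :: nat
      have "\<bar>1 - s ^ n\<bar> \<le> 1"
        using power_le_one[of s n] s by auto
      then show "norm ((cmod (a n * of_real (1 - s ^ n)))\<^sup>2) \<le> (cmod (a n))\<^sup>2"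
        by (simp add: norm_mult power_mult_distrib mult_left_le abs_square_le_1 del: of_real_diff)
    qed
    have [measurable]: "(\<lambda>z. f (of_real (t k) * z)) \<in> borel_measurable circle_measure" for k
      by (intro circle_measurable_continuous dilate_continuous t)
    have st: "0 \<le> s * r \<and> s * r < 1" if "0 \<le> r" "r < 1" for r
      using mult_mono[of s 1 r r] s that by auto
    have [measurable]: "(\<lambda>z. f (of_real s * z)) \<in> borel_measurable circle_measure"
      by (intro circle_measurable_continuous dilate_continuous s)
    let ?h = "\<lambda>k z. (cmod (f (of_real (t k) * z) - f (of_real s * (of_real (t k) * z))))\<^sup>2"
    have cont: "continuous_on (sphere 0 1) (?h k)" for k
      by (intro continuous_intros d.dilate_continuous t)
    have "(\<integral>\<^sup>+z. ennreal ((cmod (f (of_real s * z) - b z))\<^sup>2) \<partial>circle_measure) =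
        (\<integral>\<^sup>+z. liminf (\<lambda>k. ennreal (?h k z)) \<partial>circle_measure)"
    proof (rule nn_integral_cong_AE)
      show "AE z in circle_measure. ennreal ((cmod (f (of_real s * z) - b z))\<^sup>2) = liminf (\<lambda>k. ennreal (?h k z))"
        using lim AE_space
      proof eventually_elim
        case (elim z)
        then have z: "cmod z = 1" by (simp add: space_circle_measure)
        \<comment> \<open>The first term of the difference converges by the radial limit at
          \<open>z\<close>, the second by continuity of \<open>f\<close> at the interior point
          \<open>s * z\<close>.\<close>
        have 1: "(\<lambda>k. f (of_real (t k) * z)) \<longlonglongrightarrow> b z"
          by (rule filterlim_compose[OF elim(1) t(3)])
        have "t \<longlonglongrightarrow> 1"
          using t(3) by (simp add: filterlim_at)
        then have 2: "(\<lambda>k. of_real s * (of_real (t k) * z)) \<longlonglongrightarrow> of_real s * (of_real 1 * z)"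
          by (intro tendsto_intros)
        have "isCont f (of_real s * (of_real 1 * z))"
          by (rule continuous_on_interior[OF holomorphic_on_imp_continuous_on[OF holomorphic]])
             (use s z in \<open>simp add: norm_mult\<close>)
        from isCont_tendsto_compose[OF this 2]
        have "(\<lambda>k. f (of_real s * (of_real (t k) * z))) \<longlonglongrightarrow> f (of_real s * z)"
          by simp
        with 1 have "(\<lambda>k. ?h k z) \<longlonglongrightarrow> (cmod (b z - f (of_real s * z)))\<^sup>2"
          by (intro tendsto_intros)
        then have "(\<lambda>k. ennreal (?h k z)) \<longlonglongrightarrow> ennreal ((cmod (f (of_real s * z) - b z))\<^sup>2)"
          by (intro tendsto_ennrealI) (simp add: norm_minus_commute)
        then show ?case
          by (intro lim_imp_Liminf[symmetric]) auto
      qed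
    qed
    also have "\<dots> \<le> liminf (\<lambda>k. \<integral>\<^sup>+z. ennreal (?h k z) \<partial>circle_measure)"
      by (rule nn_integral_liminf) (auto intro!: measurable_compose[OF _ measurable_ennreal]
          circle_measurable_continuous cont)
    also have "\<dots> \<le> liminf (\<lambda>k. ennreal ?C)"
    proof (intro Liminf_mono always_eventually allI)
      fix k
      have "(\<integral>\<^sup>+z. ennreal (?h k z) \<partial>circle_measure) = ennreal (LINT z|circle_measure. ?h k z)"
        by (intro nn_integral_eq_integral circle_integrable_continuous cont) auto
      also have "\<dots> \<le> ennreal ?C"
        by (intro ennreal_leI d.dilate_integral_le sqd t)
      finally show "(\<integral>\<^sup>+z. ennreal (?h k z) \<partial>circle_measure) \<le> ennreal ?C" .
    qed
    also have "\<dots> = ennreal ?C"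
      by (simp add: Liminf_const)
    finally have "(\<integral>\<^sup>+z. ennreal ((cmod (f (of_real s * z) - b z))\<^sup>2) \<partial>circle_measure) \<le> ennreal ?C" .
    moreover have "circle_L2 (\<lambda>z. f (of_real s * z) - b z)"
      by (intro circle_L2_diff b holomorphic_circle_L2 holomorphic s)
    then have "(\<integral>\<^sup>+z. ennreal ((cmod (f (of_real s * z) - b z))\<^sup>2) \<partial>circle_measure) =
        ennreal (LINT z|circle_measure. (cmod (f (of_real s * z) - b z))\<^sup>2)"
      by (intro nn_integral_eq_integral) (auto simp: circle_L2_def)
    moreover have "0 \<le> ?C"
      by (intro mult_nonneg_nonneg suminf_nonneg sqd) auto
    ultimately show ?thesis
      by simp
  qed
  have t1: "t \<longlonglongrightarrow> 1"
    using t(3) by (simp add: filterlim_at)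
  \<comment> \<open>Each term tends to 0 as \<open>t k\<close> tends to 1 and is dominated by
    \<open>(cmod (a n))\<^sup>2\<close>, so the limit passes through the sum.\<close>
  have "(\<lambda>k. \<Sum>n. (cmod (a n * of_real (1 - t k ^ n)))\<^sup>2) \<longlonglongrightarrow> (\<Sum>n. 0)"
  proof (rule tannerys_theorem[THEN conjunct2, THEN conjunct2])
    show "(\<lambda>k. (cmod (a n * of_real (1 - t k ^ n)))\<^sup>2) \<longlonglongrightarrow> 0" for n
      using t1 by (auto intro!: tendsto_eq_intros)
    show "\<forall>\<^sub>F (n, k) in sequentially \<times>\<^sub>F sequentially.
        norm ((cmod (a n * of_real (1 - t k ^ n)))\<^sup>2) \<le> (cmod (a n))\<^sup>2"
    proof (intro always_eventually allI, clarify)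
      fix n k :: nat
      have "\<bar>1 - t k ^ n\<bar> \<le> 1"
        using power_le_one[of "t k" n] t(1)[of k] t(2)[of k] by auto
      then show "norm ((cmod (a n * of_real (1 - t k ^ n)))\<^sup>2) \<le> (cmod (a n))\<^sup>2"
        by (simp add: norm_mult power_mult_distrib mult_left_le abs_square_le_1 del: of_real_diff)
    qed
  qed (use sq in auto)
  then have "(\<lambda>k. 2 * pi * (\<Sum>n. (cmod (a n * of_real (1 - t k ^ n)))\<^sup>2)) \<longlonglongrightarrow> 0"
    by (intro tendsto_mult_right_zero) simp
  then show ?thesis
    by (rule tendsto_sandwich[OF always_eventually always_eventually tendsto_const, rotated 2])
       (use le[OF t(1,2)] in auto)
qed

text \<open>The error is split as \<open>f * g - b * c = (f - b) * g + b * (g - c)\<close>.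
  Cauchy-Schwarz reduces both terms to mean square convergence, the first with the uniform Hardy
  bound \<open>C\<close> for \<open>g\<close>.\<close>

lemma L2_boundary_disc_product_limit:
  fixes f g b c h :: "complex \<Rightarrow> complex"
  assumes f: "L2_boundary_disc f b" and g: "L2_boundary_disc g c"
    and h: "continuous_on (sphere 0 1) h"
    and t: "\<And>k. 0 \<le> t k" "\<And>k. t k < 1" "filterlim t (at_left 1) sequentially"
  shows "(\<lambda>k. LINT z|circle_measure. f (of_real (t k) * z) * g (of_real (t k) * z) * h z)
           \<longlonglongrightarrow> (LINT z|circle_measure. b z * c z * h z)"
proof -
  let ?f = "\<lambda>k z. f (of_real (t k) * z)" and ?g = "\<lambda>k z. g (of_real (t k) * z)"
  let ?N = "\<lambda>u. sqrt (LINT z|circle_measure. (cmod (u z))\<^sup>2)"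
  have L2: "circle_L2 b" "circle_L2 c" "circle_L2 (?f k)" "circle_L2 (?g k)" for k
    using f g t holomorphic_circle_L2 by (auto simp: L2_boundary_disc_def hardy2_def)
  have d: "circle_L2 (\<lambda>z. ?f k z - b z)" "circle_L2 (\<lambda>z. ?g k z - c z)" for k
    by (intro circle_L2_diff L2)+
  have "compact (h ` sphere 0 1)"
    by (intro compact_continuous_image h) auto
  then obtain B where B: "\<And>z. cmod z = 1 \<Longrightarrow> cmod (h z) \<le> B"
    by (force dest!: compact_imp_bounded simp: bounded_iff)
  have "0 \<le> B"
    by (rule order_trans[OF norm_ge_zero B[of 1]]) simp
  obtain C where C: "\<And>r. 0 \<le> r \<Longrightarrow> r < 1 \<Longrightarrow> (LINT z|circle_measure. (cmod (g (of_real r * z)))\<^sup>2) \<le> C"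
    using g unfolding L2_boundary_disc_def hardy2_def by force
  have hm: "h \<in> borel_measurable circle_measure"
    by (rule circle_measurable_continuous[OF h])
  have int: "integrable circle_measure (\<lambda>z. p z * h z)" if "integrable circle_measure p" for p
  proof (rule Bochner_Integration.integrable_bound)
    show "integrable circle_measure (\<lambda>z. of_real B * p z)" using that by simp
    show "(\<lambda>z. p z * h z) \<in> borel_measurable circle_measure"
      using hm that by (auto intro!: borel_measurable_times)
    show "AE z in circle_measure. norm (p z * h z) \<le> norm (of_real B * p z)"
      using B \<open>0 \<le> B\<close> by (intro AE_I2) (auto simp: space_circle_measure norm_mult mult.commute[of B] intro!: mult_left_mono)
  qed
  have bound: "norm ((LINT z|circle_measure. ?f k z * ?g k z * h z) - (LINT z|circle_measure. b z * c z * h z))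
      \<le> B * (?N (\<lambda>z. ?f k z - b z) * sqrt C + ?N b * ?N (\<lambda>z. ?g k z - c z))" for k
  proof -
    have i: "integrable circle_measure (\<lambda>z. (?f k z - b z) * ?g k z)"
      "integrable circle_measure (\<lambda>z. b z * (?g k z - c z))"
      by (intro circle_L2_integrable_mult L2 d)+
    have "(LINT z|circle_measure. ?f k z * ?g k z * h z) - (LINT z|circle_measure. b z * c z * h z) =
        (LINT z|circle_measure. ?f k z * ?g k z * h z - b z * c z * h z)"
      by (intro Bochner_Integration.integral_diff[symmetric] int circle_L2_integrable_mult L2)
    also have "\<dots> = (LINT z|circle_measure. ((?f k z - b z) * ?g k z + b z * (?g k z - c z)) * h z)"
      by (intro Bochner_Integration.integral_cong) (auto simp: algebra_simps)
    finally have "norm ((LINT z|circle_measure. ?f k z * ?g k z * h z) - (LINT z|circle_measure. b z * c z * h z)) =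
        norm (LINT z|circle_measure. ((?f k z - b z) * ?g k z + b z * (?g k z - c z)) * h z)"
      by (rule arg_cong)
    also have "\<dots> \<le> (LINT z|circle_measure. B * (cmod ((?f k z - b z) * ?g k z) + cmod (b z * (?g k z - c z))))"
    proof (rule Bochner_Integration.integral_norm_bound_integral)
      show "integrable circle_measure (\<lambda>z. ((?f k z - b z) * ?g k z + b z * (?g k z - c z)) * h z)"
        by (intro int Bochner_Integration.integrable_add i)
      show "integrable circle_measure (\<lambda>z. B * (cmod ((?f k z - b z) * ?g k z) + cmod (b z * (?g k z - c z))))"
        by (intro integrable_mult_right Bochner_Integration.integrable_add integrable_norm i)
      fix z assume "z \<in> space circle_measure"
      then have "cmod (h z) \<le> B"
        by (intro B) (simp add: space_circle_measure)
      then have "cmod ((?f k z - b z) * ?g k z + b z * (?g k z - c z)) * cmod (h z) \<le>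
          (cmod ((?f k z - b z) * ?g k z) + cmod (b z * (?g k z - c z))) * B"
        by (intro mult_mono[OF norm_triangle_ineq]) auto
      then show "norm (((?f k z - b z) * ?g k z + b z * (?g k z - c z)) * h z) \<le>
          B * (cmod ((?f k z - b z) * ?g k z) + cmod (b z * (?g k z - c z)))"
        by (subst norm_mult, subst mult.commute[of B])
    qed
    also have "\<dots> = B * ((LINT z|circle_measure. cmod ((?f k z - b z) * ?g k z)) +
        (LINT z|circle_measure. cmod (b z * (?g k z - c z))))"
      by (simp only: Bochner_Integration.integral_mult_right_zero
          Bochner_Integration.integral_add[OF integrable_norm[OF i(1)] integrable_norm[OF i(2)]])
    also have "\<dots> \<le> B * (?N (\<lambda>z. ?f k z - b z) * ?N (?g k) + ?N b * ?N (\<lambda>z. ?g k z - c z))"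
      by (rule mult_left_mono[OF add_mono[OF circle_L2_cauchy_schwarz[OF d(1) L2(4)]
            circle_L2_cauchy_schwarz[OF L2(1) d(2)]] \<open>0 \<le> B\<close>])
    also have "\<dots> \<le> B * (?N (\<lambda>z. ?f k z - b z) * sqrt C + ?N b * ?N (\<lambda>z. ?g k z - c z))"
    proof (rule mult_left_mono[OF add_right_mono \<open>0 \<le> B\<close>], rule mult_left_mono)
      show "?N (?g k) \<le> sqrt C"
        by (rule real_sqrt_le_mono[OF C[OF t(1,2)]])
      show "0 \<le> ?N (\<lambda>z. ?f k z - b z)"
        by (rule real_sqrt_ge_zero) (rule Bochner_Integration.integral_nonneg, simp)
    qed
    finally show ?thesis .
  qed
  have "(\<lambda>k. B * (?N (\<lambda>z. ?f k z - b z) * sqrt C + ?N b * ?N (\<lambda>z. ?g k z - c z))) \<longlonglongrightarrow>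
      B * (sqrt 0 * sqrt C + ?N b * sqrt 0)"
    by (intro tendsto_intros hardy2_radial_mean_limit f g t)
  then have "(\<lambda>k. B * (?N (\<lambda>z. ?f k z - b z) * sqrt C + ?N b * ?N (\<lambda>z. ?g k z - c z))) \<longlonglongrightarrow> 0"
    by simp
  then show ?thesis
    by (intro LIM_zero_cancel[OF Lim_null_comparison[OF always_eventually[OF allI[OF bound]]]])
qed

text \<open>A product of two Hardy functions is an \<open>H\<^sup>1\<close> function. Cauchy's
  formula for its dilates passes to the limit on both sides. Determinants with Hardy entries are
  differences of such products.\<close>

lemma L2_boundary_disc_cauchy_kernel:
  fixes f g b c :: "complex \<Rightarrow> complex"
  assumes f: "L2_boundary_disc f b" and g: "L2_boundary_disc g c" and w: "cmod w < 1"
  shows "(LINT z|circle_measure. b z * c z * (1 / (1 - w * cnj z))) = 2 * pi * (f w * g w)"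
proof -
  \<comment> \<open>A concrete sequence of radii in [1/2, 1) with limit 1.\<close>
  define t where "t = (\<lambda>k. 1 - 1 / real (k + 2))"
  have t: "0 \<le> t k" "t k < 1" for k
    by (auto simp: t_def field_simps)
  have t1: "t \<longlonglongrightarrow> 1"
    unfolding t_def by (rule tendsto_eq_intros LIMSEQ_ignore_initial_segment[OF lim_1_over_n] refl | simp)+
  have tl: "filterlim t (at_left 1) sequentially"
    using t t1 by (auto simp: filterlim_at intro!: always_eventually less_imp_neq)
  have hol: "f holomorphic_on ball 0 1" "g holomorphic_on ball 0 1"
    using f g by (auto simp: L2_boundary_disc_def hardy2_def)
  have ne: "1 - w * cnj z \<noteq> 0" if "cmod z = 1" for z
  proof
    assume "1 - w * cnj z = 0"
    then have "cmod (w * cnj z) = 1" by (metis eq_iff_diff_eq_0 norm_one)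
    then show False using w that by (simp add: norm_mult)
  qed
  have "(\<lambda>k. LINT z|circle_measure. f (of_real (t k) * z) * g (of_real (t k) * z) * (1 / (1 - w * cnj z)))
      \<longlonglongrightarrow> (LINT z|circle_measure. b z * c z * (1 / (1 - w * cnj z)))"
    by (rule L2_boundary_disc_product_limit[OF f g _ t tl]) (use ne in \<open>auto intro!: continuous_intros\<close>)
  moreover have "(LINT z|circle_measure. f (of_real (t k) * z) * g (of_real (t k) * z) * (1 / (1 - w * cnj z))) =
      2 * pi * (f (of_real (t k) * w) * g (of_real (t k) * w))" for k
    using disc_series.cauchy_kernel[OF holomorphic_imp_disc_series[OF holomorphic_on_mult[OF hol]] t w]
    by simp
  moreover have "(\<lambda>k. of_real (t k) * w) \<longlonglongrightarrow> of_real 1 * w"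
    by (intro tendsto_intros t1)
  then have tw: "(\<lambda>k. of_real (t k) * w) \<longlonglongrightarrow> w"
    by simp
  have "isCont f w" "isCont g w"
    using w hol by (auto intro!: continuous_on_interior[OF holomorphic_on_imp_continuous_on])
  then have "(\<lambda>k. 2 * pi * (f (of_real (t k) * w) * g (of_real (t k) * w))) \<longlonglongrightarrow> 2 * pi * (f w * g w)"
    by (intro tendsto_intros isCont_tendsto_compose[OF _ tw])
  ultimately show ?thesis
    by (simp only: LIMSEQ_unique)
qed

section \<open>Continuous boundary values, bounded multipliers and the Szego kernel\<close>

lemma tendsto_of_real_mult_at_left_1:
  "((\<lambda>r::real. of_real r * (z::complex)) \<longlongrightarrow> z) (at_left 1)"
  by (auto intro!: tendsto_eq_intros)

lemma eventually_at_left_1: "\<forall>\<^sub>F r::real in at_left 1. 0 < r \<and> r < 1"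
  using eventually_at_left_real[of 0 1] by simp

text \<open>Supplies constants and kernels as Hardy functions. A bound on the compact closed disc
  bounds all circle means.\<close>

lemma L2_boundary_disc_continuous:
  assumes f: "f holomorphic_on ball 0 1" "continuous_on (cball 0 1) f"
  shows "L2_boundary_disc f f"
  unfolding L2_boundary_disc_def hardy2_def
proof (intro conjI f(1))
  have "compact (f ` cball 0 1)"
    by (intro compact_continuous_image f) auto
  then obtain B where B: "\<And>z. cmod z \<le> 1 \<Longrightarrow> cmod (f z) \<le> B"
    by (force dest!: compact_imp_bounded simp: bounded_iff)
  show "\<exists>C. \<forall>r\<in>{0..<1}. (LINT z|circle_measure. (cmod (f (of_real r * z)))\<^sup>2) \<le> C"
  proof (intro exI ballI)
    fix r :: real assume r: "r \<in> {0..<1}"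
    then have "circle_L2 (\<lambda>z. f (of_real r * z))"
      by (intro holomorphic_circle_L2 f) auto
    then show "(LINT z|circle_measure. (cmod (f (of_real r * z)))\<^sup>2) \<le> (LINT z|circle_measure. B\<^sup>2)"
      using r by (intro integral_mono) (auto simp: circle_L2_def space_circle_measure norm_mult intro!: power_mono B)
  qed
  show "circle_L2 f"
    by (intro circle_L2_continuous continuous_on_subset[OF f(2)]) auto
  show "radial_limit_disc f f"
    unfolding radial_limit_disc_def
  proof (intro AE_I2)
    fix z assume "z \<in> space circle_measure"
    then have z: "cmod z = 1" by (simp add: space_circle_measure)
    show "((\<lambda>r. f (of_real r * z)) \<longlongrightarrow> f z) (at_left 1)"
    proof (rule continuous_on_tendsto_compose[OF f(2) tendsto_of_real_mult_at_left_1])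
      show "\<forall>\<^sub>F r in at_left 1. of_real r * z \<in> cball 0 1"
        using eventually_at_left_1 by eventually_elim (simp add: norm_mult z)
    qed (simp add: z)
  qed
qed

text \<open>The bound \<open>B\<close> on \<open>f\<close> scales the circle means of
  \<open>g\<close> by at most \<open>B\<^sup>2\<close>. This admits the products of
  \<open>exp (- chi_plus z)\<close> with bounded matrix entries.\<close>

lemma L2_boundary_disc_mult_bounded:
  fixes f g b c :: "complex \<Rightarrow> complex"
  assumes f: "f holomorphic_on ball 0 1" "\<And>z. cmod z < 1 \<Longrightarrow> cmod (f z) \<le> B"
    and b: "radial_limit_disc f b" "b \<in> borel_measurable circle_measure"
    and g: "L2_boundary_disc g c"
  shows "L2_boundary_disc (\<lambda>z. f z * g z) (\<lambda>z. b z * c z)"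
  unfolding L2_boundary_disc_def hardy2_def
proof (intro conjI)
  have gh: "g holomorphic_on ball 0 1" and c: "circle_L2 c" and cl: "radial_limit_disc g c"
    using g by (auto simp: L2_boundary_disc_def hardy2_def)
  then have cm: "c \<in> borel_measurable circle_measure"
    by (simp add: circle_L2_def)
  obtain C where C: "\<And>r. 0 \<le> r \<Longrightarrow> r < 1 \<Longrightarrow> (LINT z|circle_measure. (cmod (g (of_real r * z)))\<^sup>2) \<le> C"
    using g unfolding L2_boundary_disc_def hardy2_def by force
  have "0 \<le> B"
    by (rule order_trans[OF norm_ge_zero f(2)[of 0]]) simp
  show fg: "(\<lambda>z. f z * g z) holomorphic_on ball 0 1"
    by (intro holomorphic_on_mult f gh)
  show "\<exists>C. \<forall>r\<in>{0..<1}. (LINT z|circle_measure. (cmod (f (of_real r * z) * g (of_real r * z)))\<^sup>2) \<le> C"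
  proof (intro exI ballI)
    fix r :: real assume r: "r \<in> {0..<1}"
    have "(LINT z|circle_measure. (cmod (f (of_real r * z) * g (of_real r * z)))\<^sup>2) \<le>
        (LINT z|circle_measure. B\<^sup>2 * (cmod (g (of_real r * z)))\<^sup>2)"
    proof (intro integral_mono integrable_mult_right)
      show "integrable circle_measure (\<lambda>z. (cmod (f (of_real r * z) * g (of_real r * z)))\<^sup>2)"
        "integrable circle_measure (\<lambda>z. (cmod (g (of_real r * z)))\<^sup>2)"
        using holomorphic_circle_L2[OF fg, of r] holomorphic_circle_L2[OF gh, of r] r
        by (auto simp: circle_L2_def)
      fix z assume "z \<in> space circle_measure"
      then have "cmod (f (of_real r * z)) \<le> B"
        using r by (intro f(2)) (simp add: space_circle_measure norm_mult)
      then show "(cmod (f (of_real r * z) * g (of_real r * z)))\<^sup>2 \<le> B\<^sup>2 * (cmod (g (of_real r * z)))\<^sup>2"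
        by (auto simp: norm_mult power_mult_distrib intro!: mult_right_mono power_mono)
    qed
    also have "\<dots> = B\<^sup>2 * (LINT z|circle_measure. (cmod (g (of_real r * z)))\<^sup>2)"
      by simp
    also have "\<dots> \<le> B\<^sup>2 * C"
      using r by (intro mult_left_mono C) auto
    finally show "(LINT z|circle_measure. (cmod (f (of_real r * z) * g (of_real r * z)))\<^sup>2) \<le> B\<^sup>2 * C" .
  qed
  \<comment> \<open>The bound on \<open>f\<close> survives in the radial limit, so the product of
    boundary functions is square integrable.\<close>
  have "AE z in circle_measure. cmod (b z) \<le> B"
    using b(1)[unfolded radial_limit_disc_def] AE_space
  proof eventually_elim
    case (elim z)
    have "\<forall>\<^sub>F r in at_left 1. cmod (f (of_real r * z)) \<le> B"
      using eventually_at_left_1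
      by eventually_elim (use elim(2) in \<open>auto simp: space_circle_measure norm_mult intro!: f(2)\<close>)
    then show ?case
      by (intro tendsto_upperbound[OF tendsto_norm[OF elim(1)]]) auto
  qed
  then have bd: "AE z in circle_measure. norm ((cmod (b z * c z))\<^sup>2) \<le> norm (B\<^sup>2 * (cmod (c z))\<^sup>2)"
    by eventually_elim (auto simp: norm_mult power_mult_distrib abs_mult intro!: mult_right_mono power_mono)
  have ci: "integrable circle_measure (\<lambda>z. B\<^sup>2 * (cmod (c z))\<^sup>2)"
    using c by (auto simp: circle_L2_def)
  have bc: "(\<lambda>z. b z * c z) \<in> borel_measurable circle_measure"
    by (rule borel_measurable_times[OF b(2) cm])
  then have "(\<lambda>z. (cmod (b z * c z))\<^sup>2) \<in> borel_measurable circle_measure"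
    by (intro borel_measurable_power measurable_compose[OF _ borel_measurable_norm])
  from Bochner_Integration.integrable_bound[OF ci this bd]
  have "integrable circle_measure (\<lambda>z. (cmod (b z * c z))\<^sup>2)" .
  with bc show "circle_L2 (\<lambda>z. b z * c z)"
    unfolding circle_L2_def by (rule conjI)
  show "radial_limit_disc (\<lambda>z. f z * g z) (\<lambda>z. b z * c z)"
    unfolding radial_limit_disc_def
    using b(1)[unfolded radial_limit_disc_def] cl[unfolded radial_limit_disc_def]
    by eventually_elim (intro tendsto_mult)
qed

lemma one_minus_mult_cnj_neq_0:
  assumes "cmod w < 1" "cmod z \<le> 1"
  shows "1 - cnj w * z \<noteq> 0"
proof
  assume "1 - cnj w * z = 0"
  then have "cmod (cnj w * z) = 1" by (metis eq_iff_diff_eq_0 norm_one)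
  moreover have "cmod w * cmod z \<le> cmod w * 1"
    by (intro mult_left_mono assms) auto
  ultimately show False using assms by (simp add: norm_mult)
qed

text \<open>For nonzero \<open>w\<close> the pole \<open>1 / cnj w\<close> lies outside the closed
  disc. This is the Szego kernel; its conjugate is the Cauchy kernel used above.\<close>

lemma szego_holomorphic_continuous:
  assumes w: "cmod w < 1"
  shows "(\<lambda>z. 1 / (1 - cnj w * z)) holomorphic_on ball 0 1"
    and "continuous_on (cball 0 1) (\<lambda>z. 1 / (1 - cnj w * z))"
  using one_minus_mult_cnj_neq_0[OF w]
  by (auto intro!: holomorphic_intros continuous_intros)

text \<open>The Cauchy kernel applied to \<open>z \<mapsto> f z / (1 - cnj w * z)\<close> is the Poisson integral.\<close>

lemma L2_boundary_disc_bounded: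
  fixes f b :: "complex \<Rightarrow> complex"
  assumes f: "L2_boundary_disc f b" and B: "AE z in circle_measure. cmod (b z) \<le> B" and w: "cmod w < 1"
  shows "cmod (f w) \<le> B"
proof -
  note s = L2_boundary_disc_continuous[OF szego_holomorphic_continuous[OF w]]
  have one: "L2_boundary_disc (\<lambda>_. 1) (\<lambda>_. 1)"
    by (rule L2_boundary_disc_continuous) auto
  \<comment> \<open>On the circle this is the Poisson kernel of \<open>w\<close> up to the constant
    factor \<open>1 - (cmod w)\<^sup>2\<close>; it is the product of the Szego and Cauchy
    kernels.\<close>
  let ?P = "\<lambda>z. 1 / (cmod (1 - cnj w * z))\<^sup>2"
  have P: "1 / (1 - cnj w * z) * (1 / (1 - w * cnj z)) = of_real (?P z)" for z
    by (simp add: complex_norm_square del: of_real_power)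
  have 1: "(LINT z|circle_measure. b z * of_real (?P z)) = 2 * pi * (f w * (1 / (1 - cnj w * w)))"
    using L2_boundary_disc_cauchy_kernel[OF f s w] unfolding P mult.assoc .
  \<comment> \<open>The constant function 1 gives the mass of \<open>?P\<close>, so that
    \<open>f w\<close> becomes a weighted mean of \<open>b\<close>.\<close>
  have "(LINT z|circle_measure. of_real (?P z)) = 2 * pi * (1 / (1 - cnj w * w))"
    using L2_boundary_disc_cauchy_kernel[OF one s w] unfolding P mult.assoc mult_1 .
  then have 2: "of_real (LINT z|circle_measure. ?P z) = 2 * pi * (1 / (1 - cnj w * w))"
    by (simp only: integral_complex_of_real)
  have ne: "1 - cnj w * w \<noteq> 0"
    using one_minus_mult_cnj_neq_0[OF w, of w] w by simp
  have Pc: "continuous_on (sphere 0 1) ?P"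
    by (intro continuous_intros) (use one_minus_mult_cnj_neq_0[OF w] in auto)
  have Pi: "integrable circle_measure ?P"
    by (rule circle_integrable_continuous[OF Pc])
  have "cmod (of_real (LINT z|circle_measure. ?P z) * f w) = cmod (LINT z|circle_measure. b z * of_real (?P z))"
    unfolding 1 2 by (simp add: norm_mult norm_divide)
  also have "\<dots> \<le> (LINT z|circle_measure. cmod (b z * of_real (?P z)))"
    by (rule integral_norm_bound)
  also have "\<dots> \<le> (LINT z|circle_measure. B * ?P z)"
  proof (rule integral_mono_AE)
    have Pc': "continuous_on (sphere 0 1) (\<lambda>z. of_real (?P z) :: complex)"
      by (intro continuous_on_of_real Pc)
    show "integrable circle_measure (\<lambda>z. cmod (b z * of_real (?P z)))"
      using f by (intro integrable_norm circle_L2_integrable_mult circle_L2_continuous[OF Pc'])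
                 (simp add: L2_boundary_disc_def)
    show "integrable circle_measure (\<lambda>z. B * ?P z)"
      by (rule integrable_mult_right) (rule Pi)
    show "AE z in circle_measure. cmod (b z * of_real (?P z)) \<le> B * ?P z"
      using B
    proof eventually_elim
      case (elim z)
      have "cmod (b z * of_real (?P z)) = cmod (b z) * ?P z"
        unfolding norm_mult norm_of_real by simp
      also have "\<dots> \<le> B * ?P z"
        by (intro mult_right_mono elim) auto
      finally show ?case .
    qed
  qed
  also have "\<dots> = B * (LINT z|circle_measure. ?P z)"
    by (rule integral_mult_right_zero)
  finally have "(LINT z|circle_measure. ?P z) * cmod (f w) \<le> (LINT z|circle_measure. ?P z) * B"
    by (simp add: norm_mult mult.commute[of B] abs_of_nonneg)
  moreover have "(LINT z|circle_measure. ?P z) \<noteq> 0"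
    using 2 ne by (metis divide_eq_0_iff mult_eq_0_iff of_real_0 of_real_eq_0_iff pi_neq_zero zero_neq_numeral zero_neq_one)
  moreover have "0 \<le> (LINT z|circle_measure. ?P z)"
    by (intro Bochner_Integration.integral_nonneg_AE) auto
  ultimately show ?thesis
    by (simp add: mult_le_cancel_left)
qed

text \<open>The Szego kernel is bounded and holomorphic with value 1 at 0, so it can be absorbed
  into \<open>g\<close> without changing the value of the product at 0.\<close>

lemma L2_boundary_disc_product_mean:
  fixes f g b c :: "complex \<Rightarrow> complex"
  assumes f: "L2_boundary_disc f b" and g: "L2_boundary_disc g c" and w: "cmod w < 1"
  shows "(LINT z|circle_measure. b z * c z * (1 / (1 - cnj w * z))) = 2 * pi * (f 0 * g 0)"
proof -
  let ?h = "\<lambda>z. 1 / (1 - cnj w * z)"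
  have h: "L2_boundary_disc ?h ?h"
    by (rule L2_boundary_disc_continuous[OF szego_holomorphic_continuous[OF w]])
  have "compact (?h ` cball 0 1)"
    by (intro compact_continuous_image szego_holomorphic_continuous w) auto
  then obtain B where B: "\<And>z. cmod z \<le> 1 \<Longrightarrow> cmod (?h z) \<le> B"
    by (force dest!: compact_imp_bounded simp: bounded_iff)
  have "L2_boundary_disc (\<lambda>z. ?h z * g z) (\<lambda>z. ?h z * c z)"
    using h by (intro L2_boundary_disc_mult_bounded[where B=B] szego_holomorphic_continuous w g B)
               (auto simp: L2_boundary_disc_def circle_L2_def)
  \<comment> \<open>At the point 0 the Cauchy kernel is 1, and the formula is the mean value
    property.\<close>
  from L2_boundary_disc_cauchy_kernel[OF f this, of 0]
  have "(LINT z|circle_measure. b z * (?h z * c z) * (1 / (1 - 0 * cnj z))) = 2 * pi * (f 0 * (?h 0 * g 0))"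
    by simp
  moreover have "(\<lambda>z. b z * (?h z * c z) * (1 / (1 - 0 * cnj z))) = (\<lambda>z. b z * c z * ?h z)"
    by (auto simp: fun_eq_iff)
  ultimately show ?thesis
    by (simp only: mult_zero_right diff_zero div_by_1 mult_1)
qed

text \<open>An \<open>H\<^sup>1\<close> function whose boundary values are those of an antiholomorphic \<open>H\<^sup>1\<close> function
  is constant: the Cauchy kernel reproduces the former and averages the latter.\<close>

lemma det_holomorphic_antiholomorphic_const:
  fixes f1 f2 f3 f4 p1 p2 p3 p4 b1 b2 b3 b4 c1 c2 c3 c4 :: "complex \<Rightarrow> complex" and \<kappa> w :: complex
  assumes f: "L2_boundary_disc f1 b1" "L2_boundary_disc f2 b2" "L2_boundary_disc f3 b3" "L2_boundary_disc f4 b4"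
    and p: "L2_boundary_disc p1 c1" "L2_boundary_disc p2 c2" "L2_boundary_disc p3 c3" "L2_boundary_disc p4 c4"
    and eq: "AE z in circle_measure. b1 z * b2 z - b3 z * b4 z = \<kappa> * cnj (c1 z * c2 z - c3 z * c4 z)"
    and w: "cmod w < 1"
  shows "f1 w * f2 w - f3 w * f4 w = \<kappa> * cnj (p1 0 * p2 0 - p3 0 * p4 0)"
proof -
  let ?h = "\<lambda>z. 1 / (1 - cnj w * z)" and ?h' = "\<lambda>z. 1 / (1 - w * cnj z)"
  \<comment> \<open>Under conjugation the Cauchy integral of the antiholomorphic side becomes a
    Szego integral of a holomorphic product.\<close>
  have h': "?h' = (\<lambda>z. cnj (?h z))" by auto
  have L2: "circle_L2 b1" "circle_L2 b2" "circle_L2 b3" "circle_L2 b4"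
    "circle_L2 c1" "circle_L2 c2" "circle_L2 c3" "circle_L2 c4"
    using f p by (auto simp: L2_boundary_disc_def)
  have hc: "continuous_on (sphere 0 1) ?h"
    by (rule continuous_on_subset[OF szego_holomorphic_continuous(2)[OF w]]) auto
  have hc': "continuous_on (sphere 0 1) ?h'"
    unfolding h' by (intro continuous_intros hc)
  have int: "integrable circle_measure (\<lambda>z. u z * v z * k z)"
    if "circle_L2 u" "circle_L2 v" "continuous_on (sphere 0 1) k" for u v k
  proof -
    have "compact (k ` sphere 0 1)"
      by (intro compact_continuous_image that) auto
    then obtain B where B: "\<And>z. cmod z = 1 \<Longrightarrow> cmod (k z) \<le> B"
      by (force dest!: compact_imp_bounded simp: bounded_iff)
    then have "0 \<le> B"
      by (intro order_trans[OF norm_ge_zero B[of 1]]) simp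
    show ?thesis
    proof (rule Bochner_Integration.integrable_bound)
      show "integrable circle_measure (\<lambda>z. of_real B * (u z * v z))"
        by (intro integrable_mult_right circle_L2_integrable_mult that)
      show "(\<lambda>z. u z * v z * k z) \<in> borel_measurable circle_measure"
        using that circle_measurable_continuous[OF that(3)]
        by (auto simp: circle_L2_def intro!: borel_measurable_times)
      show "AE z in circle_measure. norm (u z * v z * k z) \<le> norm (of_real B * (u z * v z))"
        using B \<open>0 \<le> B\<close> by (intro AE_I2) (auto simp: space_circle_measure norm_mult mult.commute[of B] intro!: mult_left_mono)
    qed
  qed
  have "2 * pi * (f1 w * f2 w - f3 w * f4 w) =
      (LINT z|circle_measure. b1 z * b2 z * ?h' z) - (LINT z|circle_measure. b3 z * b4 z * ?h' z)"
    unfolding L2_boundary_disc_cauchy_kernel[OF f(1,2) w] L2_boundary_disc_cauchy_kernel[OF f(3,4) w]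
    by (simp add: algebra_simps)
  also have "\<dots> = (LINT z|circle_measure. b1 z * b2 z * ?h' z - b3 z * b4 z * ?h' z)"
    by (intro Bochner_Integration.integral_diff[symmetric] int L2 hc')
  also have "\<dots> = (LINT z|circle_measure. \<kappa> * cnj (c1 z * c2 z * ?h z - c3 z * c4 z * ?h z))"
  proof (rule integral_cong_AE)
    have [measurable]: "b1 \<in> borel_measurable circle_measure" "b2 \<in> borel_measurable circle_measure"
      "b3 \<in> borel_measurable circle_measure" "b4 \<in> borel_measurable circle_measure"
      "c1 \<in> borel_measurable circle_measure" "c2 \<in> borel_measurable circle_measure"
      "c3 \<in> borel_measurable circle_measure" "c4 \<in> borel_measurable circle_measure"
      "?h \<in> borel_measurable circle_measure" "?h' \<in> borel_measurable circle_measure"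
      using L2 circle_measurable_continuous[OF hc] circle_measurable_continuous[OF hc']
      by (auto simp: circle_L2_def)
    show "(\<lambda>z. b1 z * b2 z * ?h' z - b3 z * b4 z * ?h' z) \<in> borel_measurable circle_measure"
      by (intro borel_measurable_diff borel_measurable_times) measurable
    have "continuous_on UNIV cnj"
      by (intro continuous_intros)
    then show "(\<lambda>z. \<kappa> * cnj (c1 z * c2 z * ?h z - c3 z * c4 z * ?h z)) \<in> borel_measurable circle_measure"
      by (intro borel_measurable_times borel_measurable_const
           borel_measurable_continuous_on[of cnj] borel_measurable_diff) measurable
    show "AE z in circle_measure. b1 z * b2 z * ?h' z - b3 z * b4 z * ?h' z =
        \<kappa> * cnj (c1 z * c2 z * ?h z - c3 z * c4 z * ?h z)"
      using eq
    proof eventually_elim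
      case (elim z)
      have "b1 z * b2 z * ?h' z - b3 z * b4 z * ?h' z = (b1 z * b2 z - b3 z * b4 z) * cnj (?h z)"
        by (simp add: left_diff_distrib[symmetric] diff_divide_distrib)
      also have "\<dots> = \<kappa> * cnj ((c1 z * c2 z - c3 z * c4 z) * ?h z)"
        unfolding elim by simp
      finally show ?case
        by (simp add: algebra_simps diff_divide_distrib)
    qed
  qed
  also have "\<dots> = \<kappa> * cnj (LINT z|circle_measure. c1 z * c2 z * ?h z - c3 z * c4 z * ?h z)"
    by (simp only: integral_mult_right_zero Bochner_Integration.integral_cnj)
  also have "(LINT z|circle_measure. c1 z * c2 z * ?h z - c3 z * c4 z * ?h z) =
      (LINT z|circle_measure. c1 z * c2 z * ?h z) - (LINT z|circle_measure. c3 z * c4 z * ?h z)"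
    by (intro Bochner_Integration.integral_diff int L2 hc)
  also have "\<dots> = 2 * pi * (p1 0 * p2 0 - p3 0 * p4 0)"
    unfolding L2_boundary_disc_product_mean[OF p(1,2) w] L2_boundary_disc_product_mean[OF p(3,4) w]
    by (simp add: algebra_simps)
  finally have "of_real (2 * pi) * (f1 w * f2 w - f3 w * f4 w) = of_real (2 * pi) * (\<kappa> * cnj (p1 0 * p2 0 - p3 0 * p4 0))"
    by simp
  then show ?thesis
    by (simp only: mult_cancel_left of_real_eq_0_iff mult_eq_0_iff pi_neq_zero) simp
qed

section \<open>Triangular factorization\<close>

lemma mat2_nth [simp]:
  "mat2 a b c d $ 1 $ 1 = a" "mat2 a b c d $ 1 $ 2 = b"
  "mat2 a b c d $ 2 $ 1 = c" "mat2 a b c d $ 2 $ 2 = d"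
  by (simp_all add: mat2_def)

lemma mat2_eqI:
  fixes A B :: cmat2
  assumes "A $ 1 $ 1 = B $ 1 $ 1" "A $ 1 $ 2 = B $ 1 $ 2" "A $ 2 $ 1 = B $ 2 $ 1" "A $ 2 $ 2 = B $ 2 $ 2"
  shows "A = B"
  using assms by (simp add: vec_eq_iff forall_2)

lemma mat2_mult: "mat2 a b c d ** mat2 e f g h =
    mat2 (a * e + b * g) (a * f + b * h) (c * e + d * g) (c * f + d * h)"
  by (intro mat2_eqI) (simp_all add: matrix_matrix_mult_def sum_2)

lemma mat2_eta: "A = mat2 (A $ 1 $ 1) (A $ 1 $ 2) (A $ 2 $ 1) (A $ 2 $ 2)"
  by (intro mat2_eqI) simp_all

lemma det_mat2: "det (mat2 a b c d) = a * d - b * c"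
  by (simp add: det_2)

lemma conj_transpose_mat2: "conj_transpose (mat2 a b c d) = mat2 (cnj a) (cnj c) (cnj b) (cnj d)"
  by (intro mat2_eqI) (simp_all add: conj_transpose_def map_matrix_def transpose_def)

lemma mat_1_mat2: "mat 1 = mat2 1 0 0 1"
  by (intro mat2_eqI) (simp_all add: mat_def)

text \<open>The second row is orthogonal to the unit first row, and the determinant fixes its
  remaining scalar.\<close>

lemma SU2_form:
  assumes "A \<in> SU2"
  obtains a b where "A = mat2 a b (- cnj b) (cnj a)" "a * cnj a + b * cnj b = 1"
proof -
  define a b c d where abcd: "a = A $ 1 $ 1" "b = A $ 1 $ 2" "c = A $ 2 $ 1" "d = A $ 2 $ 2"
  have A: "A = mat2 a b c d"
    unfolding abcd by (rule mat2_eta)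
  have "mat2 a b c d ** conj_transpose (mat2 a b c d) = mat2 1 0 0 1" and det: "a * d - b * c = 1"
    using assms by (auto simp: SU2_def A det_mat2 mat_1_mat2)
  then have *: "a * cnj a + b * cnj b = 1" "c * cnj a + d * cnj b = 0"
    unfolding conj_transpose_mat2 mat2_mult by (metis mat2_nth)+
  \<comment> \<open>The determinant is 1 and the added inner product is 0; regrouping brings out the
    norm of the first row as the factor of \<open>d\<close>.\<close>
  have "cnj a = cnj a * (a * d - b * c) + b * (c * cnj a + d * cnj b)"
    by (simp add: det *)
  also have "\<dots> = (a * cnj a + b * cnj b) * d"
    by algebra
  finally have d: "d = cnj a"
    by (simp add: *)
  have "- cnj b = - cnj b * (a * d - b * c) + a * (c * cnj a + d * cnj b)"
    by (simp add: det *)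
  also have "\<dots> = (a * cnj a + b * cnj b) * c"
    by algebra
  finally have "c = - cnj b"
    by (simp add: *)
  then show ?thesis
    using that[of a b] A d * by simp
qed

text \<open>Makes the factorization of the inverse loop a statement about the adjoint of
  \<open>g\<close>.\<close>

lemma SU2_matrix_inv:
  assumes "A \<in> SU2"
  shows "matrix_inv A = conj_transpose A"
proof -
  obtain a b where A: "A = mat2 a b (- cnj b) (cnj a)" "a * cnj a + b * cnj b = 1"
    using SU2_form[OF assms] .
  have l: "conj_transpose A ** A = mat 1"
    using A(2) unfolding A(1) conj_transpose_mat2 mat2_mult mat_1_mat2
    by (intro mat2_eqI) (simp_all add: algebra_simps)
  have r: "A ** conj_transpose A = mat 1"
    using assms by (simp add: SU2_def)
  then have "\<exists>A'. A ** A' = mat 1 \<and> A' ** A = mat 1"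
    using l by blast
  \<comment> \<open>\<open>matrix_inv\<close> is defined by choice, so its property follows once a
    two-sided inverse is exhibited.\<close>
  then have "A ** matrix_inv A = mat 1"
    unfolding matrix_inv_def by (rule someI2_ex) blast
  then have "conj_transpose A ** (A ** matrix_inv A) = conj_transpose A"
    by simp
  then show ?thesis
    by (simp add: matrix_mul_assoc l)
qed

section \<open>Bounded rows of the factors \<open>k1\<close> and \<open>k2\<close>\<close>

lemma radial_limit_ext_const:
  assumes "L2_boundary_ext (\<lambda>_. c) d b"
  shows "AE z in circle_measure. b z = c"
proof -
  have "AE z in circle_measure. ((\<lambda>r::real. c) \<longlongrightarrow> b z) (at_right 1)"
    using assms by (simp add: L2_boundary_ext_def radial_limit_ext_def)
  then show ?thesis
    by eventually_elim (auto simp: tendsto_const_iff)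
qed

lemma sphere_AE:
  assumes "\<forall>z\<in>sphere 0 1. P z"
  shows "AE z in circle_measure. P z"
  using assms by (intro AE_I2) (simp add: space_circle_measure)

text \<open>The scaled pair is a unit vector, so each of its entries has modulus at most 1.\<close>

lemma cmod_le_of_norm_eq_1:
  assumes "a > 0" "(of_real a * x) * cnj (of_real a * x) + (of_real a * y) * cnj (of_real a * y) = 1"
  shows "cmod x \<le> inverse a" "cmod y \<le> inverse a"
proof -
  have "of_real ((cmod (of_real a * x))\<^sup>2 + (cmod (of_real a * y))\<^sup>2) = (1::complex)"
    using assms(2) by (simp only: of_real_add complex_norm_square)
  then have "(cmod (of_real a * x))\<^sup>2 + (cmod (of_real a * y))\<^sup>2 = 1"
    by (simp only: of_real_eq_1_iff)
  then have s: "(a * cmod x)\<^sup>2 + (a * cmod y)\<^sup>2 = 1"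
    using assms(1) by (simp add: norm_mult)
  have "(a * cmod x)\<^sup>2 \<le> 1" "(a * cmod y)\<^sup>2 \<le> 1"
    using s zero_le_power2[of "a * cmod x"] zero_le_power2[of "a * cmod y"] by linarith+
  then have "a * cmod x \<le> 1" "a * cmod y \<le> 1"
    by (auto intro: power2_le_imp_le)
  then show "cmod x \<le> inverse a" "cmod y \<le> inverse a"
    using assms(1) by (simp_all add: field_simps)
qed

text \<open>The factor \<open>l\<close> has first row \<open>(1, 0)\<close> in (I.3) and second row \<open>(0, 1)\<close> in (II.3), so this row
  of the loop is that of \<open>a u\<close>. Unitarity bounds it on the circle, hence in the disc.\<close>

lemma triangular_form_I3_first_row:
  assumes k: "triangular_form_I3 k" "SU2_loop k"
  obtains a \<alpha> \<alpha>b \<beta> \<beta>b where "a > 0" "L2_boundary_disc \<alpha> \<alpha>b" "L2_boundary_disc \<beta> \<beta>b" "\<alpha> 0 = 1"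
    "\<forall>z\<in>ball 0 1. cmod (\<alpha> z) \<le> inverse a" "\<forall>z\<in>ball 0 1. cmod (\<beta> z) \<le> inverse a"
    "AE z in circle_measure. k z = mat2 (of_real a * \<alpha>b z) (of_real a * \<beta>b z)
       (- cnj (of_real a * \<beta>b z)) (cnj (of_real a * \<alpha>b z))"
proof -
  obtain y f a u where "triangular_factorization_by k (\<lambda>z. mat2 1 0 (f z) 1) (mat2 1 0 (cnj (y 0)) 1) 1 a u"
    using k(1) unfolding triangular_form_I3_def by (elim exE conjE) (rule that)
  then obtain lb ub where a: "0 < a"
    and l: "lower_factor (\<lambda>z. mat2 1 0 (f z) 1) (mat2 1 0 (cnj (y 0)) 1) lb"
    and u: "upper_factor u ub"
    and eq: "AE z in circle_measure. k z = lb z ** mat2 1 0 0 (inverse 1)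
      ** mat2 (of_real a) 0 0 (inverse (of_real a)) ** ub z"
    unfolding triangular_factorization_by_def by blast
  have "L2_boundary_ext (\<lambda>z. mat2 1 0 (f z) 1 $ i $ j) (mat2 1 0 (cnj (y 0)) 1 $ i $ j) (\<lambda>z. lb z $ i $ j)" for i j
    using l unfolding lower_factor_def by blast
  \<comment> \<open>These entries of the exterior factor are constant, which determines the
    otherwise unspecified boundary matrix \<open>lb\<close> there.\<close>
  from this[of 1 1] this[of 1 2]
  have lb: "AE z in circle_measure. lb z $ 1 $ 1 = 1" "AE z in circle_measure. lb z $ 1 $ 2 = 0"
    by (auto dest: radial_limit_ext_const)
  have ub: "L2_boundary_disc (\<lambda>z. u z $ i $ j) (\<lambda>z. ub z $ i $ j)" for i j
    using u unfolding upper_factor_def by blast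
  have kS: "AE z in circle_measure. k z \<in> SU2"
    using k(2) by (intro sphere_AE) (simp add: SU2_loop_def)
  have form: "AE z in circle_measure.
      k z = mat2 (of_real a * ub z $ 1 $ 1) (of_real a * ub z $ 1 $ 2)
       (- cnj (of_real a * ub z $ 1 $ 2)) (cnj (of_real a * ub z $ 1 $ 1)) \<and>
      cmod (ub z $ 1 $ 1) \<le> inverse a \<and> cmod (ub z $ 1 $ 2) \<le> inverse a"
    using eq lb kS
  proof eventually_elim
    case (elim z)
    obtain p q where pq: "k z = mat2 p q (- cnj q) (cnj p)" "p * cnj p + q * cnj q = 1"
      using SU2_form[OF elim(4)] .
    have "k z = mat2 1 0 (lb z $ 2 $ 1) (lb z $ 2 $ 2) ** mat2 1 0 0 (inverse 1)
      ** mat2 (of_real a) 0 0 (inverse (of_real a)) **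
      mat2 (ub z $ 1 $ 1) (ub z $ 1 $ 2) (ub z $ 2 $ 1) (ub z $ 2 $ 2)"
      using elim(1) mat2_eta[of "lb z"] mat2_eta[of "ub z"] by (simp add: elim(2,3))
    then have "p = of_real a * ub z $ 1 $ 1" "q = of_real a * ub z $ 1 $ 2"
      unfolding pq(1) mat2_mult by (auto dest!: arg_cong[where f="\<lambda>A. (A $ 1 $ 1, A $ 1 $ 2)"])
    with pq cmod_le_of_norm_eq_1[OF a] show ?case
      by blast
  qed
  have one: "u 0 $ 1 $ 1 = 1"
    using u unfolding upper_factor_def by auto
  show ?thesis
    by (rule that[OF a ub[of 1 1] ub[of 1 2] one])
       (use form in \<open>auto elim!: eventually_mono intro!: L2_boundary_disc_bounded[OF ub]\<close>)
qed

lemma triangular_form_II3_second_row: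
  assumes k: "triangular_form_II3 k" "SU2_loop k"
  obtains a \<gamma> \<gamma>b \<delta> \<delta>b where "a > 0" "L2_boundary_disc \<gamma> \<gamma>b" "L2_boundary_disc \<delta> \<delta>b" "\<gamma> 0 = 0" "\<delta> 0 = 1"
    "\<forall>z\<in>ball 0 1. cmod (\<gamma> z) \<le> a" "\<forall>z\<in>ball 0 1. cmod (\<delta> z) \<le> a"
    "AE z in circle_measure. k z = mat2 (cnj (\<delta>b z / of_real a)) (- cnj (\<gamma>b z / of_real a))
       (\<gamma>b z / of_real a) (\<delta>b z / of_real a) \<and>
       \<gamma>b z / of_real a * cnj (\<gamma>b z / of_real a) + \<delta>b z / of_real a * cnj (\<delta>b z / of_real a) = 1"
proof -
  obtain x f a u where "triangular_factorization_by k (\<lambda>z. mat2 1 (f z) 0 1) (mat2 1 0 0 1) 1 a u"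
    using k(1) unfolding triangular_form_II3_def by (elim exE conjE) (rule that)
  then obtain lb ub where a: "0 < a"
    and l: "lower_factor (\<lambda>z. mat2 1 (f z) 0 1) (mat2 1 0 0 1) lb"
    and u: "upper_factor u ub"
    and eq: "AE z in circle_measure. k z = lb z ** mat2 1 0 0 (inverse 1)
      ** mat2 (of_real a) 0 0 (inverse (of_real a)) ** ub z"
    unfolding triangular_factorization_by_def by blast
  have "L2_boundary_ext (\<lambda>z. mat2 1 (f z) 0 1 $ i $ j) (mat2 1 0 0 1 $ i $ j) (\<lambda>z. lb z $ i $ j)" for i j
    using l unfolding lower_factor_def by blast
  from this[of 2 1] this[of 2 2]
  have lb: "AE z in circle_measure. lb z $ 2 $ 1 = 0" "AE z in circle_measure. lb z $ 2 $ 2 = 1"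
    by (auto dest: radial_limit_ext_const)
  have ub: "L2_boundary_disc (\<lambda>z. u z $ i $ j) (\<lambda>z. ub z $ i $ j)" for i j
    using u unfolding upper_factor_def by blast
  have kS: "AE z in circle_measure. k z \<in> SU2"
    using k(2) by (intro sphere_AE) (simp add: SU2_loop_def)
  have form: "AE z in circle_measure.
      (k z = mat2 (cnj (ub z $ 2 $ 2 / of_real a)) (- cnj (ub z $ 2 $ 1 / of_real a))
       (ub z $ 2 $ 1 / of_real a) (ub z $ 2 $ 2 / of_real a) \<and>
       ub z $ 2 $ 1 / of_real a * cnj (ub z $ 2 $ 1 / of_real a) +
       ub z $ 2 $ 2 / of_real a * cnj (ub z $ 2 $ 2 / of_real a) = 1) \<and>
      cmod (ub z $ 2 $ 1) \<le> a \<and> cmod (ub z $ 2 $ 2) \<le> a"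
    using eq lb kS
  proof eventually_elim
    case (elim z)
    obtain p q where pq: "k z = mat2 p q (- cnj q) (cnj p)" "p * cnj p + q * cnj q = 1"
      using SU2_form[OF elim(4)] .
    have "k z = mat2 (lb z $ 1 $ 1) (lb z $ 1 $ 2) 0 1 ** mat2 1 0 0 (inverse 1)
      ** mat2 (of_real a) 0 0 (inverse (of_real a)) **
      mat2 (ub z $ 1 $ 1) (ub z $ 1 $ 2) (ub z $ 2 $ 1) (ub z $ 2 $ 2)"
      using elim(1) mat2_eta[of "lb z"] mat2_eta[of "ub z"] by (simp add: elim(2,3))
    then have e: "- cnj q = ub z $ 2 $ 1 / of_real a" "cnj p = ub z $ 2 $ 2 / of_real a"
      unfolding pq(1) mat2_mult
      by (auto simp: field_simps dest!: arg_cong[where f="\<lambda>A. (A $ 2 $ 1, A $ 2 $ 2)"])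
    then have p: "p = cnj (ub z $ 2 $ 2 / of_real a)" and q: "q = - cnj (ub z $ 2 $ 1 / of_real a)"
      by (metis complex_cnj_cnj, metis complex_cnj_cnj complex_cnj_minus minus_minus)
    have n: "ub z $ 2 $ 1 / of_real a * cnj (ub z $ 2 $ 1 / of_real a) +
       ub z $ 2 $ 2 / of_real a * cnj (ub z $ 2 $ 2 / of_real a) = 1"
      using pq(2) unfolding p q by (simp add: ac_simps)
    \<comment> \<open>The second row of the diagonal factor carries \<open>inverse a\<close>, so the
      estimate is applied with that scale and yields the bound \<open>a\<close>.\<close>
    have "cmod (ub z $ 2 $ 1) \<le> inverse (inverse a)" "cmod (ub z $ 2 $ 2) \<le> inverse (inverse a)"
      by (rule cmod_le_of_norm_eq_1[where y="ub z $ 2 $ 2"] cmod_le_of_norm_eq_1[where x="ub z $ 2 $ 1"];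
          use a n in \<open>simp add: field_simps\<close>)+
    with n e pq p q show ?case
      by simp
  qed
  have zero: "u 0 $ 2 $ 1 = 0" and one: "u 0 $ 2 $ 2 = 1"
    using u unfolding upper_factor_def by auto
  show ?thesis
    by (rule that[OF a ub[of 2 1] ub[of 2 2] zero one])
       (use form in \<open>auto elim!: eventually_mono intro!: L2_boundary_disc_bounded[OF ub]\<close>)
qed

text \<open>The witnesses are \<open>(p, q) = exp (- \<chi>\<^sub>+) (\<alpha>\<^sub>1, \<beta>\<^sub>1)\<close> and
  \<open>(r, s) = exp (- \<chi>\<^sub>+) (\<gamma>\<^sub>2, \<delta>\<^sub>2)\<close>; no bound on \<open>exp \<chi>\<^sub>+\<close> is involved.\<close>

lemma root_factorization_column:
  assumes k: "triangular_form_I3 k1" "SU2_loop k1" "triangular_form_II3 k2" "SU2_loop k2"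
    and chi: "imaginary_exponent chi chi_plus" "\<exists>b. L2_boundary_disc (\<lambda>z. exp (- chi_plus z)) b"
    and g: "AE z in circle_measure.
        g z = conj_transpose (k1 z) ** mat2 (exp (chi z)) 0 0 (exp (- chi z)) ** k2 z"
  obtains m0 a0 p q r s pb qb rb sb where "cmod m0 = 1" "a0 > 0"
    "L2_boundary_disc p pb" "L2_boundary_disc q qb" "L2_boundary_disc r rb" "L2_boundary_disc s sb"
    "p 0 = 1" "r 0 = 0" "s 0 = 1"
    "AE z in circle_measure.
       g z $ 1 $ 1 * sb z - g z $ 1 $ 2 * rb z = m0 * of_real a0 * cnj (pb z) \<and>
       g z $ 2 $ 1 * sb z - g z $ 2 $ 2 * rb z = m0 * of_real a0 * cnj (qb z)"
proof -
  obtain a1 \<alpha> \<alpha>b \<beta> \<beta>b where 1: "a1 > 0" "L2_boundary_disc \<alpha> \<alpha>b" "L2_boundary_disc \<beta> \<beta>b" "\<alpha> 0 = 1"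
    "\<forall>z\<in>ball 0 1. cmod (\<alpha> z) \<le> inverse a1" "\<forall>z\<in>ball 0 1. cmod (\<beta> z) \<le> inverse a1"
    "AE z in circle_measure. k1 z = mat2 (of_real a1 * \<alpha>b z) (of_real a1 * \<beta>b z)
       (- cnj (of_real a1 * \<beta>b z)) (cnj (of_real a1 * \<alpha>b z))"
    using triangular_form_I3_first_row[OF k(1,2)] .
  obtain a2 \<gamma> \<gamma>b \<delta> \<delta>b where 2: "a2 > 0" "L2_boundary_disc \<gamma> \<gamma>b" "L2_boundary_disc \<delta> \<delta>b" "\<gamma> 0 = 0" "\<delta> 0 = 1"
    "\<forall>z\<in>ball 0 1. cmod (\<gamma> z) \<le> a2" "\<forall>z\<in>ball 0 1. cmod (\<delta> z) \<le> a2"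
    "AE z in circle_measure. k2 z = mat2 (cnj (\<delta>b z / of_real a2)) (- cnj (\<gamma>b z / of_real a2))
       (\<gamma>b z / of_real a2) (\<delta>b z / of_real a2) \<and>
       \<gamma>b z / of_real a2 * cnj (\<gamma>b z / of_real a2) + \<delta>b z / of_real a2 * cnj (\<delta>b z / of_real a2) = 1"
    using triangular_form_II3_second_row[OF k(3,4)] .
  obtain e where e: "L2_boundary_disc (\<lambda>z. exp (- chi_plus z)) e"
    using chi(2) ..
  obtain chi0 b where chi0: "Re chi0 = 0" "chi_plus 0 = 0" and b: "radial_limit_disc chi_plus b"
    and chi_eq: "AE z in circle_measure. chi z = - cnj (b z) + chi0 + b z"
    using chi(1) unfolding imaginary_exponent_def by blast
  \<comment> \<open>Uniqueness of radial limits ties the boundary function \<open>e\<close> to the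
    boundary function \<open>b\<close> of \<open>chi_plus\<close>.\<close>
  have "AE z in circle_measure. e z = exp (- b z)"
    using b[unfolded radial_limit_disc_def] e[unfolded L2_boundary_disc_def radial_limit_disc_def, THEN conjunct2, THEN conjunct2]
  proof eventually_elim
    case (elim z)
    have "((\<lambda>r. exp (- chi_plus (of_real r * z))) \<longlongrightarrow> exp (- b z)) (at_left 1)"
      by (intro tendsto_intros elim(1))
    then show ?case
      by (intro tendsto_unique[OF _ elim(2)]) auto
  qed
  \<comment> \<open>Subtracting \<open>b\<close> from \<open>chi\<close> leaves
    \<open>chi0 - cnj b\<close>. Thus multiplication by \<open>exp chi\<close> turns the holomorphic
    boundary value \<open>e\<close> into its antiholomorphic conjugate.\<close>
  then have ez: "AE z in circle_measure. exp (chi z) * e z = exp chi0 * cnj (e z)"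
    using chi_eq
  proof eventually_elim
    case (elim z)
    have "exp (chi z) * e z = exp (chi z + (- b z))"
      by (simp add: elim(1) exp_add[symmetric])
    also have "chi z + (- b z) = chi0 + cnj (- b z)"
      by (simp add: elim(2))
    also have "exp \<dots> = exp chi0 * cnj (e z)"
      by (simp only: elim(1) exp_add exp_cnj)
    finally show ?case .
  qed
  have L2: "L2_boundary_disc (\<lambda>z. u z * exp (- chi_plus z)) (\<lambda>z. ub z * e z)"
    if "L2_boundary_disc u ub" "\<forall>z\<in>ball 0 1. cmod (u z) \<le> B" for u ub B
    by (rule L2_boundary_disc_mult_bounded[OF _ _ _ _ e])
       (use that in \<open>auto simp: L2_boundary_disc_def hardy2_def circle_L2_def\<close>)
  have main: "AE z in circle_measure.
      g z $ 1 $ 1 * (\<delta>b z * e z) - g z $ 1 $ 2 * (\<gamma>b z * e z) = exp chi0 * of_real (a1 * a2) * cnj (\<alpha>b z * e z) \<and>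
      g z $ 2 $ 1 * (\<delta>b z * e z) - g z $ 2 $ 2 * (\<gamma>b z * e z) = exp chi0 * of_real (a1 * a2) * cnj (\<beta>b z * e z)"
    using 1(7) 2(8) ez g
  proof eventually_elim
    case (elim z)
    define C D where CD: "C = \<gamma>b z / of_real a2" "D = \<delta>b z / of_real a2"
    define A B where AB: "A = of_real a1 * \<alpha>b z" "B = of_real a1 * \<beta>b z"
    have CD': "\<gamma>b z = of_real a2 * C" "\<delta>b z = of_real a2 * D"
      using 2(1) by (simp_all add: CD)
    have n: "C * cnj C + D * cnj D = 1"
      using elim(2) by (simp add: CD)
    have k1: "k1 z = mat2 A B (- cnj B) (cnj A)" and k2: "k2 z = mat2 (cnj D) (- cnj C) C D"
      using elim(1,2) unfolding AB CD by blast+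
    have gz: "g z = mat2 (cnj A * exp (chi z) * cnj D - B * exp (- chi z) * C)
       (- cnj A * exp (chi z) * cnj C - B * exp (- chi z) * D)
       (cnj B * exp (chi z) * cnj D + A * exp (- chi z) * C)
       (- cnj B * exp (chi z) * cnj C + A * exp (- chi z) * D)"
      unfolding elim(4) k1 k2 conj_transpose_mat2 mat2_mult by simp
    \<comment> \<open>\<open>k2\<close> sends the column \<open>(D, - C)\<close> to
      \<open>(1, 0)\<close>, so only \<open>exp (chi z)\<close> enters and the terms with
      \<open>exp (- chi z)\<close> cancel. The adjoint of \<open>k1\<close> then gives the column
      \<open>(cnj A, cnj B)\<close>.\<close>
    have "g z $ 1 $ 1 * (\<delta>b z * e z) - g z $ 1 $ 2 * (\<gamma>b z * e z) =
        of_real a2 * cnj A * (exp (chi z) * e z) * (C * cnj C + D * cnj D)"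
      unfolding gz CD' mat2_nth by algebra
    moreover have "g z $ 2 $ 1 * (\<delta>b z * e z) - g z $ 2 $ 2 * (\<gamma>b z * e z) =
        of_real a2 * cnj B * (exp (chi z) * e z) * (C * cnj C + D * cnj D)"
      unfolding gz CD' mat2_nth by algebra
    ultimately show ?case
      unfolding n elim(3) AB by simp
  qed
  \<comment> \<open>Since \<open>chi0\<close> is imaginary, \<open>exp chi0\<close> is unimodular
    and serves as \<open>m0\<close>; the positive number \<open>a1 * a2\<close> serves as
    \<open>a0\<close>.\<close>
  show ?thesis
    by (rule that[OF _ _ L2[OF 1(2,5)] L2[OF 1(3,6)] L2[OF 2(2,6)] L2[OF 2(3,7)] _ _ _ main])
       (use 1 2 chi0 in auto)
qed

section \<open>Reflection in the circle and assembly of the factorization\<close>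

lemma L2_boundary_ext_reflect:
  assumes f: "L2_boundary_disc f b"
  shows "L2_boundary_ext (\<lambda>z. cnj (f (inverse (cnj z)))) (cnj (f 0)) (\<lambda>z. cnj (b z))"
  unfolding L2_boundary_ext_def
proof (intro conjI)
  \<comment> \<open>The inversion of the chart cancels that of the reflection and leaves only the
    two conjugations.\<close>
  have "at_infinity_chart (\<lambda>z. cnj (f (inverse (cnj z)))) (cnj (f 0)) = (\<lambda>w. cnj (f (cnj w)))"
    by (auto simp: at_infinity_chart_def fun_eq_iff)
  then show "hardy2 (at_infinity_chart (\<lambda>z. cnj (f (inverse (cnj z)))) (cnj (f 0)))"
    using f hardy2_cnj by (simp add: L2_boundary_disc_def)
  have "circle_L2 b"
    using f by (simp add: L2_boundary_disc_def)
  moreover have "continuous_on UNIV cnj"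
    by (intro continuous_intros)
  ultimately show "circle_L2 (\<lambda>z. cnj (b z))"
    by (auto simp: circle_L2_def intro!: borel_measurable_continuous_on[of cnj])
  show "radial_limit_ext (\<lambda>z. cnj (f (inverse (cnj z)))) (\<lambda>z. cnj (b z))"
    unfolding radial_limit_ext_def
    using f[unfolded L2_boundary_disc_def radial_limit_disc_def, THEN conjunct2, THEN conjunct2] AE_space
  proof eventually_elim
    case (elim z)
    then have "z * cnj z = 1"
      by (simp add: space_circle_measure complex_norm_square[symmetric])
    then have z: "inverse (cnj z) = z"
      by (metis inverse_unique mult.commute)
    \<comment> \<open>The reflection fixes \<open>z\<close> and inverts the radius, so an approach
      from outside becomes one from inside.\<close>
    have "filterlim (inverse :: real \<Rightarrow> real) (at_left 1) (at_right 1)"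
    proof (rule tendsto_imp_filterlim_at_left)
      show "((inverse :: real \<Rightarrow> real) \<longlongrightarrow> 1) (at_right 1)"
        by (auto intro!: tendsto_eq_intros)
      show "\<forall>\<^sub>F r::real in at_right 1. inverse r < 1"
        using eventually_at_right_less[of "1::real"] by eventually_elim (simp add: field_simps)
    qed
    from filterlim_compose[OF elim(1) this]
    have "((\<lambda>r. cnj (f (of_real (inverse r) * z))) \<longlongrightarrow> cnj (b z)) (at_right 1)"
      by (intro tendsto_intros)
    then show ?case
      by (simp add: z)
  qed
qed

lemma L2_boundary_disc_holomorphic: "L2_boundary_disc f b \<Longrightarrow> f holomorphic_on ball 0 1"
  by (simp add: L2_boundary_disc_def hardy2_def)

lemma L2_boundary_ext_holomorphic: "L2_boundary_ext f c b \<Longrightarrow> at_infinity_chart f c holomorphic_on ball 0 1"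
  by (simp add: L2_boundary_ext_def hardy2_def)

theorem theorem3p2:
  fixes g k1 k2 k1' k2' :: "complex \<Rightarrow> complex^2^2"
    and chi chi' chi_plus chi'_plus :: "complex \<Rightarrow> complex"
  assumes "SU2_loop g"
    and "SU2_loop k1" and "SU2_loop k2" and "SU2_loop k1'" and "SU2_loop k2'"
    and "imaginary_exponent chi chi_plus" and "imaginary_exponent chi' chi'_plus"
    and "AE z in circle_measure.
           g z = conj_transpose (k1 z) ** mat2 (exp (chi z)) 0 0 (exp (- chi z)) ** k2 z"
    and "AE z in circle_measure.
           matrix_inv (g z) =
             conj_transpose (k1' z) ** mat2 (exp (chi' z)) 0 0 (exp (- chi' z)) ** k2' z"
    and "\<exists>b. L2_boundary_disc (\<lambda>z. exp (- chi_plus z)) b"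
    and "\<exists>b. L2_boundary_disc (\<lambda>z. exp (- chi'_plus z)) b"
    and "triangular_form_I3 k1" and "triangular_form_I3 k1'"
    and "triangular_form_II3 k2" and "triangular_form_II3 k2'"
  shows "has_triangular_factorization g"
proof -
  obtain m a p q r s pb qb rb sb where ma: "cmod m = 1" "a > 0"
    and L: "L2_boundary_disc p pb" "L2_boundary_disc q qb" "L2_boundary_disc r rb" "L2_boundary_disc s sb"
    and zero: "p 0 = 1" "r 0 = 0" "s 0 = 1"
    and col: "AE z in circle_measure.
       g z $ 1 $ 1 * sb z - g z $ 1 $ 2 * rb z = m * of_real a * cnj (pb z) \<and>
       g z $ 2 $ 1 * sb z - g z $ 2 $ 2 * rb z = m * of_real a * cnj (qb z)"
    using root_factorization_column[OF assms(12,2,14,3,6,10,8)] .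
  obtain m' a' p' q' r' s' pb' qb' rb' sb' where ma': "cmod m' = 1" "a' > 0"
    and L': "L2_boundary_disc p' pb'" "L2_boundary_disc q' qb'" "L2_boundary_disc r' rb'" "L2_boundary_disc s' sb'"
    and zero': "p' 0 = 1" "r' 0 = 0" "s' 0 = 1"
    and col': "AE z in circle_measure.
       matrix_inv (g z) $ 1 $ 1 * sb' z - matrix_inv (g z) $ 1 $ 2 * rb' z = m' * of_real a' * cnj (pb' z) \<and>
       matrix_inv (g z) $ 2 $ 1 * sb' z - matrix_inv (g z) $ 2 $ 2 * rb' z = m' * of_real a' * cnj (qb' z)"
    using root_factorization_column[OF assms(13,4,15,5,7,11,9)] .
  \<comment> \<open>\<open>\<kappa>\<close> is the upper diagonal entry obtained from
    \<open>g\<close>, \<open>\<mu>\<close> the conjugate of the one obtained from the inverse; they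
    are shown to agree below.\<close>
  define \<kappa> where "\<kappa> = m * of_real a"
  define \<mu> where "\<mu> = cnj (m' * of_real a')"
  have nz: "\<kappa> \<noteq> 0" "\<mu> \<noteq> 0"
    using ma ma' by (auto simp: \<kappa>_def \<mu>_def)
  have gS: "AE z in circle_measure. g z \<in> SU2"
    using assms(1) by (intro sphere_AE) (simp add: SU2_loop_def)
  \<comment> \<open>The first pair gives the column \<open>g (s, - r)\<close>. The second pair gives
    the column \<open>g (- q', p')\<close>, by conjugating the relations for the adjoint and
    multiplying by \<open>g\<close>. Together they are the columns of \<open>g\<close> times the
    adjugate of the future \<open>u\<close>.\<close>
  have rel: "AE z in circle_measure. det (g z) = 1 \<and>
      g z $ 1 $ 1 * sb z - g z $ 1 $ 2 * rb z = \<kappa> * cnj (pb z) \<and>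
      g z $ 2 $ 1 * sb z - g z $ 2 $ 2 * rb z = \<kappa> * cnj (qb z) \<and>
      \<mu> * (g z $ 1 $ 2 * pb' z - g z $ 1 $ 1 * qb' z) = cnj (rb' z) \<and>
      \<mu> * (g z $ 2 $ 2 * pb' z - g z $ 2 $ 1 * qb' z) = cnj (sb' z)"
    using gS col col'
  proof eventually_elim
    case (elim z)
    obtain x y where g: "g z = mat2 x y (- cnj y) (cnj x)" "x * cnj x + y * cnj y = 1"
      using SU2_form[OF elim(1)] .
    have "cnj x * sb' z + y * rb' z = cnj \<mu> * cnj (pb' z)" "cnj y * sb' z - x * rb' z = cnj \<mu> * cnj (qb' z)"
      using elim(3)[unfolded SU2_matrix_inv[OF elim(1)]] unfolding g(1) conj_transpose_mat2 mat2_nth by (simp_all add: \<mu>_def)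
    from this[THEN arg_cong[where f=cnj]]
    have h: "\<mu> * pb' z = x * cnj (sb' z) + cnj y * cnj (rb' z)" "\<mu> * qb' z = y * cnj (sb' z) - cnj x * cnj (rb' z)"
      by simp_all
    have "\<mu> * (y * pb' z - x * qb' z) = (x * cnj x + y * cnj y) * cnj (rb' z)"
      using h by algebra
    moreover have "\<mu> * (cnj x * pb' z + cnj y * qb' z) = (x * cnj x + y * cnj y) * cnj (sb' z)"
      using h by algebra
    moreover have "det (g z) = 1"
      using elim(1) by (simp add: SU2_def)
    ultimately show ?case
      using elim(2) g by (simp add: \<kappa>_def)
  qed
  \<comment> \<open>Determinants of both sides of the column equations, with
    \<open>det (g z) = 1\<close>: holomorphic on the left, antiholomorphic on the right.\<close>
  have dets: "AE z in circle_measure. pb' z * sb z - qb' z * rb z = \<kappa> / \<mu> * cnj (pb z * sb' z - rb' z * qb z)"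
    using rel
  proof eventually_elim
    case (elim z)
    define g11 g12 g21 g22 where g: "g11 = g z $ 1 $ 1" "g12 = g z $ 1 $ 2" "g21 = g z $ 2 $ 1" "g22 = g z $ 2 $ 2"
    have d: "g11 * g22 - g12 * g21 = 1"
      using elim by (simp add: det_2 g)
    have "\<kappa> * (cnj (pb z) * cnj (sb' z) - cnj (rb' z) * cnj (qb z)) =
        (\<kappa> * cnj (pb z)) * cnj (sb' z) - cnj (rb' z) * (\<kappa> * cnj (qb z))"
      by (simp add: algebra_simps)
    also have "\<dots> = (g11 * sb z - g12 * rb z) * (\<mu> * (g22 * pb' z - g21 * qb' z)) -
        (\<mu> * (g12 * pb' z - g11 * qb' z)) * (g21 * sb z - g22 * rb z)"
      using elim by (simp add: g)
    also have "\<dots> = \<mu> * ((g11 * g22 - g12 * g21) * (pb' z * sb z - qb' z * rb z))"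
      by algebra
    finally show ?case
      using nz by (simp add: d field_simps)
  qed
  have U: "p' w * s w - q' w * r w = \<kappa> / \<mu>" if "cmod w < 1" for w
    using det_holomorphic_antiholomorphic_const[OF L'(1) L(4) L'(2) L(3) L(1) L'(4) L'(3) L(2) dets that]
    by (simp add: zero zero')
  \<comment> \<open>At 0 the left side is 1 by the normalizations, which forces the constant to be
    1.\<close>
  from this[of 0] have \<kappa>\<mu>: "\<mu> = \<kappa>"
    using nz by (simp add: zero zero')
  have U1: "p' w * s w - q' w * r w = 1" if "cmod w < 1" for w
    using U[OF that] nz by (simp add: \<kappa>\<mu>)
  \<comment> \<open>The same relation conjugated, with the two sides exchanged: it yields the
    determinant of the exterior factor.\<close>
  have "AE z in circle_measure. pb z * sb' z - rb' z * qb z = 1 * cnj (pb' z * sb z - qb' z * rb z)"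
    using dets by eventually_elim (use nz in \<open>simp add: \<kappa>\<mu>\<close>)
  from det_holomorphic_antiholomorphic_const[OF L(1) L'(4) L'(3) L(2) L'(1) L(4) L'(2) L(3) this]
  have L1: "p w * s' w - r' w * q w = 1" if "cmod w < 1" for w
    using that by (simp add: zero zero')
  \<comment> \<open>The determinant identity is also needed on the circle, where \<open>g\<close> is
    recovered from its product with the inverse of \<open>u\<close>.\<close>
  have Ub1: "AE z in circle_measure. pb' z * sb z - qb' z * rb z = 1"
    using L'(1,2)[unfolded L2_boundary_disc_def radial_limit_disc_def, THEN conjunct2, THEN conjunct2]
      L(3,4)[unfolded L2_boundary_disc_def radial_limit_disc_def, THEN conjunct2, THEN conjunct2] AE_space
  proof eventually_elim
    case (elim z)
    have "((\<lambda>t. p' (of_real t * z) * s (of_real t * z) - q' (of_real t * z) * r (of_real t * z)) \<longlongrightarrow>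
        pb' z * sb z - qb' z * rb z) (at_left 1)"
      by (intro tendsto_intros elim)
    moreover have "\<forall>\<^sub>F t in at_left 1.
        p' (of_real t * z) * s (of_real t * z) - q' (of_real t * z) * r (of_real t * z) = 1"
      using eventually_at_left_1
      by eventually_elim (rule U1, use elim in \<open>simp add: space_circle_measure norm_mult\<close>)
    ultimately have "((\<lambda>t::real. 1) \<longlongrightarrow> pb' z * sb z - qb' z * rb z) (at_left 1)"
      by (rule Lim_transform_eventually)
    then show ?case
      by (simp add: tendsto_const_iff)
  qed
  \<comment> \<open>The second row of \<open>?u\<close> and the first column of \<open>?l\<close>
    come from \<open>g\<close>, the first row of \<open>?u\<close> and the second column of
    \<open>?l\<close> from its inverse. The reflection \<open>?R\<close> moves functions to the
    exterior; only \<open>q 0\<close> is unconstrained in \<open>?linf\<close>.\<close>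
  let ?u = "\<lambda>z. mat2 (p' z) (q' z) (r z) (s z)" and ?ub = "\<lambda>z. mat2 (pb' z) (qb' z) (rb z) (sb z)"
  let ?R = "\<lambda>f z. cnj (f (inverse (cnj z)))"
  let ?l = "\<lambda>z. mat2 (?R p z) (?R r' z) (?R q z) (?R s' z)"
  let ?lb = "\<lambda>z. mat2 (cnj (pb z)) (cnj (rb' z)) (cnj (qb z)) (cnj (sb' z))"
  let ?linf = "mat2 1 0 (cnj (q 0)) 1"
  have upper: "upper_factor ?u ?ub"
    unfolding upper_factor_def forall_2 mat2_nth det_mat2
    using U1 zero zero' L L' L2_boundary_disc_holomorphic[OF L'(1)] L2_boundary_disc_holomorphic[OF L'(2)]
      L2_boundary_disc_holomorphic[OF L(3)] L2_boundary_disc_holomorphic[OF L(4)] by auto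
  have E: "L2_boundary_ext (?R p) 1 (\<lambda>z. cnj (pb z))" "L2_boundary_ext (?R r') 0 (\<lambda>z. cnj (rb' z))"
    "L2_boundary_ext (?R q) (cnj (q 0)) (\<lambda>z. cnj (qb z))" "L2_boundary_ext (?R s') 1 (\<lambda>z. cnj (sb' z))"
    using L2_boundary_ext_reflect[OF L(1)] L2_boundary_ext_reflect[OF L'(3)]
      L2_boundary_ext_reflect[OF L(2)] L2_boundary_ext_reflect[OF L'(4)] by (simp_all add: zero zero')
  have "?R p z * ?R s' z - ?R r' z * ?R q z = 1" if "1 < cmod z" for z
  proof -
    have "cmod (inverse (cnj z)) < 1"
      using that by (simp add: norm_inverse inverse_less_1_iff del: inverse_eq_divide)
    from L1[OF this, THEN arg_cong[where f=cnj]] show ?thesis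
      by simp
  qed
  then have lower: "lower_factor ?l ?linf ?lb"
    unfolding lower_factor_def forall_2 mat2_nth det_mat2
    using E E[THEN L2_boundary_ext_holomorphic] by auto
  have "AE z in circle_measure.
      g z = ?lb z ** mat2 m 0 0 (inverse m) ** mat2 (of_real a) 0 0 (inverse (of_real a)) ** ?ub z"
    using rel Ub1
  proof eventually_elim
    case (elim z)
    define g11 g12 g21 g22 where g: "g11 = g z $ 1 $ 1" "g12 = g z $ 1 $ 2" "g21 = g z $ 2 $ 1" "g22 = g z $ 2 $ 2"
    have c: "g11 * sb z - g12 * rb z = \<kappa> * cnj (pb z)" "g21 * sb z - g22 * rb z = \<kappa> * cnj (qb z)"
      "g12 * pb' z - g11 * qb' z = cnj (rb' z) * inverse \<kappa>" "g22 * pb' z - g21 * qb' z = cnj (sb' z) * inverse \<kappa>"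
      using elim(1) nz by (auto simp: g \<kappa>\<mu> field_simps)
    have d: "pb' z * sb z - qb' z * rb z = 1"
      by (rule elim(2))
    \<comment> \<open>Multiplying the two columns by \<open>?ub\<close> recovers the entries of
      \<open>g\<close>, because the determinant of \<open>?ub\<close> is 1.\<close>
    have "g11 = (g11 * sb z - g12 * rb z) * pb' z + (g12 * pb' z - g11 * qb' z) * rb z"
      "g12 = (g11 * sb z - g12 * rb z) * qb' z + (g12 * pb' z - g11 * qb' z) * sb z"
      "g21 = (g21 * sb z - g22 * rb z) * pb' z + (g22 * pb' z - g21 * qb' z) * rb z"
      "g22 = (g21 * sb z - g22 * rb z) * qb' z + (g22 * pb' z - g21 * qb' z) * sb z"
      using d by algebra+
    then have "g z = mat2 (\<kappa> * cnj (pb z) * pb' z + cnj (rb' z) * inverse \<kappa> * rb z)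
        (\<kappa> * cnj (pb z) * qb' z + cnj (rb' z) * inverse \<kappa> * sb z)
        (\<kappa> * cnj (qb z) * pb' z + cnj (sb' z) * inverse \<kappa> * rb z)
        (\<kappa> * cnj (qb z) * qb' z + cnj (sb' z) * inverse \<kappa> * sb z)"
      unfolding c by (intro mat2_eqI) (simp_all flip: g)
    then show ?case
      unfolding mat2_mult by (simp add: \<kappa>_def inverse_mult_distrib ac_simps)
  qed
  with lower upper have "triangular_factorization_by g ?l ?linf m a ?u"
    unfolding triangular_factorization_by_def using ma by blast
  then show ?thesis
    unfolding has_triangular_factorization_def by blast
qed

end
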